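(* Let $m$ be even, $\alpha\ge\frac2m$, let $\tau$ be a permutation of $\{1,\ldots,m\}$ and let $H_1,\ldots,H_m$ be nonnegative matrices that define operators on $l^2(R)$. For $j=1,\ldots,\frac m2$ let $A_j=H_{\tau(2j-1)}^*H_{\tau(2j)}$ and $A_{\frac m2+j}=A_j^*=H_{\tau(2j)}^*H_{\tau(2j-1)}$, and let $S_i=A_i\cdots A_{\frac m2}A_1\cdots A_{i-1}$ for $i=1,\ldots,\frac m2$. Then $$\|H_1^{(\alpha)}\circ\cdots\circ H_m^{(\alpha)}\|\le r\big(A_1^{(\alpha)}\circ\cdots\circ A_m^{(\alpha)}\big)^{\frac12}\le r\big(A_1^{(\alpha)}\circ\cdots\circ A_{\frac m2}^{(\alpha)}\big)$$ $$=r\big((H_{\tau(1)}^*H_{\tau(2)})^{(\alpha)}\circ(H_{\tau(3)}^*H_{\tau(4)})^{(\alpha)}\circ\cdots\circ(H_{\tau(m-1)}^*H_{\tau(m)})^{(\alpha)}\big)$$ $$\le r\big(S_1^{(\alpha)}\circ S_2^{(\alpha)}\circ\cdots\circ S_{\frac m2}^{(\alpha)}\big)^{\frac2m}\le r\big(H_{\tau(1)}^*H_{\tau(2)}H_{\tau(3)}^*H_{\tau(4)}\cdots H_{\tau(m-1)}^*H_{\tau(m)}\big)^{\alpha}.$$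
   Context: $R$ is $\{1,\ldots,N\}$ for some $N\in\mathbb N$ or $R=\mathbb N$. A matrix $K=[k(i,j)]_{i,j\in R}$ with entries $\ge0$ is nonnegative; it defines an operator on $l^2(R)$ if $Kx\in l^2(R)$ for all $x\in l^2(R)$, where $(Kx)_i=\sum_jk(i,j)x_j$ (it is then automatically bounded). $K^*$ is the transpose, juxtaposition is the ordinary matrix product, $\circ$ is the entrywise (Hadamard) product and $K^{(t)}=[k(i,j)^t]$ is the entrywise power. $r$ is the spectral radius and $\|\cdot\|$ the operator norm on $l^2(R)$. *)

theory Defs
  imports "HOL-Analysis.Analysis" "HOL-Combinatorics.Permutations"
begin

text \<open>
  Throughout, \<open>R\<close> is the index set, and \<open>l\<^sup>2(R)\<close> is the complex Hilbert space, so that the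
  spectrum has its usual meaning. Its elements are represented by functions on \<open>nat\<close> that
  vanish outside \<open>R\<close>; this makes equality of vectors equality of functions.
  The entries of a matrix outside \<open>R \<times> R\<close> are irrelevant.
\<close>

definition index_set :: "nat set \<Rightarrow> bool" where
  "index_set R \<longleftrightarrow> (\<exists>N\<ge>1. R = {1..N}) \<or> R = {1..}"

definition l2 :: "nat set \<Rightarrow> (nat \<Rightarrow> complex) set" where
  "l2 R = {x. (\<forall>i. i \<notin> R \<longrightarrow> x i = 0) \<and> (\<lambda>i. (cmod (x i))\<^sup>2) summable_on R}"

definition l2norm :: "nat set \<Rightarrow> (nat \<Rightarrow> complex) \<Rightarrow> real" where
  "l2norm R x = sqrt (\<Sum>\<^sub>\<infinity>i\<in>R. (cmod (x i))\<^sup>2)"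

definition bounded_operator ::
  "nat set \<Rightarrow> ((nat \<Rightarrow> complex) \<Rightarrow> (nat \<Rightarrow> complex)) \<Rightarrow> bool" where
  "bounded_operator R T \<longleftrightarrow>
     (\<forall>x\<in>l2 R. T x \<in> l2 R) \<and>
     (\<forall>x\<in>l2 R. \<forall>y\<in>l2 R. T (\<lambda>i. x i + y i) = (\<lambda>i. T x i + T y i)) \<and>
     (\<forall>x\<in>l2 R. \<forall>c. T (\<lambda>i. c * x i) = (\<lambda>i. c * T x i)) \<and>
     (\<exists>C. \<forall>x\<in>l2 R. l2norm R (T x) \<le> C * l2norm R x)"

definition operator_norm ::
  "nat set \<Rightarrow> ((nat \<Rightarrow> complex) \<Rightarrow> (nat \<Rightarrow> complex)) \<Rightarrow> real" where
  "operator_norm R T = Sup {l2norm R (T x) | x. x \<in> l2 R \<and> l2norm R x \<le> 1}"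

text \<open>The \<open>z\<close> for which \<open>z I - T\<close> has no inverse among the bounded operators on \<open>l\<^sup>2(R)\<close>.\<close>

definition operator_spectrum ::
  "nat set \<Rightarrow> ((nat \<Rightarrow> complex) \<Rightarrow> (nat \<Rightarrow> complex)) \<Rightarrow> complex set" where
  "operator_spectrum R T = {z. \<not> (\<exists>B. bounded_operator R B \<and>
     (\<forall>x\<in>l2 R. B (\<lambda>i. z * x i - T x i) = x \<and> (\<lambda>i. z * B x i - T (B x) i) = x))}"

definition operator_spectral_radius ::
  "nat set \<Rightarrow> ((nat \<Rightarrow> complex) \<Rightarrow> (nat \<Rightarrow> complex)) \<Rightarrow> real" where
  "operator_spectral_radius R T = Sup (cmod ` operator_spectrum R T)"

type_synonym rmat = "nat \<Rightarrow> nat \<Rightarrow> real"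

definition nonneg_mat :: "nat set \<Rightarrow> rmat \<Rightarrow> bool" where
  "nonneg_mat R K \<longleftrightarrow> (\<forall>i\<in>R. \<forall>j\<in>R. 0 \<le> K i j)"

definition mat_op :: "nat set \<Rightarrow> rmat \<Rightarrow> (nat \<Rightarrow> complex) \<Rightarrow> (nat \<Rightarrow> complex)" where
  "mat_op R K x = (\<lambda>i. if i \<in> R then \<Sum>\<^sub>\<infinity>j\<in>R. of_real (K i j) * x j else 0)"

text \<open>
  The summability clause is needed because a non-convergent \<open>infsum\<close> has the value 0.
  For a row that pairs with every \<open>x \<in> l\<^sup>2(R)\<close>, convergence and absolute convergence agree.
\<close>

definition defines_operator :: "nat set \<Rightarrow> rmat \<Rightarrow> bool" where
  "defines_operator R K \<longleftrightarrow>
     (\<forall>x\<in>l2 R. (\<forall>i\<in>R. (\<lambda>j. of_real (K i j) * x j) summable_on R) \<and> mat_op R K x \<in> l2 R)"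

definition mat_norm :: "nat set \<Rightarrow> rmat \<Rightarrow> real" where
  "mat_norm R K = operator_norm R (mat_op R K)"

definition mat_spectral_radius :: "nat set \<Rightarrow> rmat \<Rightarrow> real" where
  "mat_spectral_radius R K = operator_spectral_radius R (mat_op R K)"

definition mat_adj :: "rmat \<Rightarrow> rmat" where
  "mat_adj K = (\<lambda>i j. K j i)"

definition mat_times :: "nat set \<Rightarrow> rmat \<Rightarrow> rmat \<Rightarrow> rmat" where
  "mat_times R K L = (\<lambda>i j. \<Sum>\<^sub>\<infinity>k\<in>R. K i k * L k j)"

definition mat_one :: rmat where
  "mat_one = (\<lambda>i j. if i = j then 1 else 0)"

definition mat_prod_list :: "nat set \<Rightarrow> rmat list \<Rightarrow> rmat" where
  "mat_prod_list R Ks = foldr (mat_times R) Ks mat_one"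

definition hadamard_pow :: "real \<Rightarrow> rmat \<Rightarrow> rmat" where
  "hadamard_pow t K = (\<lambda>i j. K i j powr t)"

definition hadamard_pow_prod :: "real \<Rightarrow> (nat \<Rightarrow> rmat) \<Rightarrow> nat \<Rightarrow> rmat" where
  "hadamard_pow_prod t K n = (\<lambda>i j. \<Prod>l=1..n. hadamard_pow t (K l) i j)"

end

theory Submission
  imports Defs
begin

text \<open>
  Write \<open>p = m/2\<close>, so that \<open>p \<alpha> \<ge> 1\<close>, and \<open>K\<^sub>1\<^sup>(\<^sup>\<alpha>\<^sup>) \<circ> \<dots> \<circ> K\<^sub>n\<^sup>(\<^sup>\<alpha>\<^sup>)\<close> for the Hadamard product of
  entrywise powers. Everything rests on two facts.

  The first is Hoelder's inequality (\<open>Holder_infsum\<close>), which for \<open>n \<alpha> \<ge> 1\<close> gives the entrywise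
  bound
  \<open>(K\<^sub>1\<^sup>(\<^sup>\<alpha>\<^sup>) \<circ> \<dots> \<circ> K\<^sub>n\<^sup>(\<^sup>\<alpha>\<^sup>)) (L\<^sub>1\<^sup>(\<^sup>\<alpha>\<^sup>) \<circ> \<dots> \<circ> L\<^sub>n\<^sup>(\<^sup>\<alpha>\<^sup>)) \<le> (K\<^sub>1 L\<^sub>1)\<^sup>(\<^sup>\<alpha>\<^sup>) \<circ> \<dots> \<circ> (K\<^sub>n L\<^sub>n)\<^sup>(\<^sup>\<alpha>\<^sup>)\<close>
  (\<open>mat_times_hadamard_le\<close>). Together with the norm estimate \<open>mat_bound_hadamard\<close> it bounds the
  powers of a Hadamard product, and so \<open>r(K\<^sub>1\<^sup>(\<^sup>\<alpha>\<^sup>) \<circ> \<dots> \<circ> K\<^sub>n\<^sup>(\<^sup>\<alpha>\<^sup>)) \<le> (r(K\<^sub>1) \<dots> r(K\<^sub>n))\<^sup>\<alpha>\<close>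
  (\<open>growth_hadamard\<close>).

  The second is the formula \<open>r(K) = lim \<parallel>K\<^sup>n\<parallel>\<^sup>1\<^sup>/\<^sup>n\<close> for nonnegative \<open>K\<close>, in the form that \<open>r(K)\<close> is the
  infimum of the growth rates of the powers. The Neumann series shows that nothing in the spectrum
  exceeds a growth rate. Conversely, the infimum \<open>s\<^sub>0\<close> of the growth rates is itself in the spectrum
  (\<open>growth_Inf_in_spectrum\<close>); nonnegativity gives this without any complex analysis, because a
  nonnegative Neumann series dominates its terms and hence a resolvent that stays bounded near
  \<open>s\<^sub>0\<close> bounds the powers.

  The four inequalities then follow. For \<open>M = H\<^sub>1\<^sup>(\<^sup>\<alpha>\<^sup>) \<circ> \<dots> \<circ> H\<^sub>m\<^sup>(\<^sup>\<alpha>\<^sup>)\<close> one has \<open>\<parallel>M\<parallel>\<^sup>2 = r(M\<^sup>* M)\<close>, and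
  the Hadamard factors of \<open>M\<^sup>*\<close> and \<open>M\<close> can be paired so that their products are
  \<open>A\<^sub>1, \<dots>, A\<^sub>m\<close>. For \<open>B = A\<^sub>1\<^sup>(\<^sup>\<alpha>\<^sup>) \<circ> \<dots> \<circ> A\<^sub>p\<^sup>(\<^sup>\<alpha>\<^sup>)\<close> the Hadamard product of all \<open>m\<close> factors is
  \<open>B \<circ> B\<^sup>*\<close>, and \<open>r(B \<circ> B\<^sup>*) \<le> r(B)\<^sup>2\<close>. In \<open>B\<^sup>p\<close> the Hadamard factors can be shifted cyclically from
  one copy of \<open>B\<close> to the next, which yields \<open>B\<^sup>p \<le> S\<^sub>1\<^sup>(\<^sup>\<alpha>\<^sup>) \<circ> \<dots> \<circ> S\<^sub>p\<^sup>(\<^sup>\<alpha>\<^sup>)\<close>. Finally, all \<open>S\<^sub>i\<close> have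
  the spectral radius of \<open>A\<^sub>1 \<dots> A\<^sub>p\<close>, as \<open>r(XY) = r(YX)\<close>.
\<close>

section \<open>Vectors in a Hilbert sequence space\<close>

lemma l2_boundI:
  assumes "\<And>i. i \<notin> R \<Longrightarrow> x i = 0" "0 \<le> C"
    and "\<And>F. finite F \<Longrightarrow> F \<subseteq> R \<Longrightarrow> L2_set (\<lambda>i. cmod (x i)) F \<le> C"
  shows "x \<in> l2 R" "l2norm R x \<le> C"
proof -
  have fin: "(\<Sum>i\<in>F. (cmod (x i))\<^sup>2) \<le> C\<^sup>2" if "finite F" "F \<subseteq> R" for F
  proof -
    have "sqrt (\<Sum>i\<in>F. (cmod (x i))\<^sup>2) \<le> C"
      using assms(3)[OF that] by (simp add: L2_set_def)
    then show ?thesis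
      by (rule sqrt_le_D)
  qed
  have summ: "(\<lambda>i. (cmod (x i))\<^sup>2) summable_on R"
    by (rule nonneg_bdd_above_summable_on) (auto intro!: bdd_aboveI2[where M = "C\<^sup>2"] fin)
  then show "x \<in> l2 R"
    using assms(1) by (auto simp: l2_def)
  have "(\<Sum>\<^sub>\<infinity>i\<in>R. (cmod (x i))\<^sup>2) \<le> C\<^sup>2"
    by (rule infsum_le_finite_sums[OF summ fin])
  then show "l2norm R x \<le> C"
    using assms(2) by (simp add: l2norm_def real_le_lsqrt)
qed

lemma L2_set_le_l2norm:
  assumes "x \<in> l2 R" "finite F" "F \<subseteq> R"
  shows "L2_set (\<lambda>i. cmod (x i)) F \<le> l2norm R x"
  unfolding L2_set_def l2norm_def
  using assms by (intro real_sqrt_le_mono finite_sum_le_infsum) (auto simp: l2_def)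

lemma l2_outside: "x \<in> l2 R \<Longrightarrow> i \<notin> R \<Longrightarrow> x i = 0"
  by (simp add: l2_def)

lemma l2norm_nonneg [simp]: "0 \<le> l2norm R x"
  by (simp add: l2norm_def infsum_nonneg)

lemma cmod_le_l2norm:
  assumes "x \<in> l2 R"
  shows "cmod (x i) \<le> l2norm R x"
proof (cases "i \<in> R")
  case True
  then show ?thesis
    using L2_set_le_l2norm[OF assms, of "{i}"] by (simp add: L2_set_def)
qed (simp add: l2_outside[OF assms])

lemma zero_in_l2: "(\<lambda>i. 0) \<in> l2 R"
  by (simp add: l2_def)

lemma
  assumes "x \<in> l2 R" "y \<in> l2 R"
  shows l2_add: "(\<lambda>i. x i + y i) \<in> l2 R"
    and l2norm_triangle: "l2norm R (\<lambda>i. x i + y i) \<le> l2norm R x + l2norm R y"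
proof -
  have "L2_set (\<lambda>i. cmod (x i + y i)) F \<le> l2norm R x + l2norm R y" if "finite F" "F \<subseteq> R" for F
  proof -
    have "L2_set (\<lambda>i. cmod (x i + y i)) F \<le> L2_set (\<lambda>i. cmod (x i) + cmod (y i)) F"
      by (intro L2_set_mono norm_triangle_ineq) auto
    also have "\<dots> \<le> L2_set (\<lambda>i. cmod (x i)) F + L2_set (\<lambda>i. cmod (y i)) F"
      by (rule L2_set_triangle_ineq)
    also have "\<dots> \<le> l2norm R x + l2norm R y"
      using assms that by (intro add_mono L2_set_le_l2norm)
    finally show ?thesis .
  qed
  then show "(\<lambda>i. x i + y i) \<in> l2 R" "l2norm R (\<lambda>i. x i + y i) \<le> l2norm R x + l2norm R y"
    using l2_outside[OF assms(1)] l2_outside[OF assms(2)]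
    by (intro l2_boundI[of R "\<lambda>i. x i + y i" "l2norm R x + l2norm R y"]; simp)+
qed

lemma l2norm_scale: "l2norm R (\<lambda>i. c * x i) = cmod c * l2norm R x"
  unfolding l2norm_def
  by (simp add: norm_mult power_mult_distrib infsum_cmult_right' real_sqrt_mult)

lemma l2_scale: "x \<in> l2 R \<Longrightarrow> (\<lambda>i. c * x i) \<in> l2 R"
  by (auto simp: l2_def norm_mult power_mult_distrib intro: summable_on_cmult_right)

lemma
  assumes "x \<in> l2 R" "y \<in> l2 R"
  shows l2_diff: "(\<lambda>i. x i - y i) \<in> l2 R"
    and l2norm_diff: "l2norm R (\<lambda>i. x i - y i) \<le> l2norm R x + l2norm R y"
  using l2_add[OF assms(1) l2_scale[OF assms(2), of "-1"]]
    l2norm_triangle[OF assms(1) l2_scale[OF assms(2), of "-1"]] l2norm_scale[of R "-1" y]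
  by simp_all

lemma
  fixes x :: "nat \<Rightarrow> complex"
  assumes "finite F" "F \<subseteq> R"
  shows finite_support_in_l2: "(\<lambda>i. if i \<in> F then x i else 0) \<in> l2 R"
    and l2norm_finite_support:
      "l2norm R (\<lambda>i. if i \<in> F then x i else 0) = L2_set (\<lambda>i. cmod (x i)) F"
proof -
  have hs: "((\<lambda>i. (cmod (if i \<in> F then x i else 0))\<^sup>2) has_sum (\<Sum>i\<in>F. (cmod (x i))\<^sup>2)) R"
    by (rule has_sum_finite_neutralI) (use assms in auto)
  then show "(\<lambda>i. if i \<in> F then x i else 0) \<in> l2 R"
    using assms(2) has_sum_imp_summable[OF hs] unfolding l2_def by auto
  show "l2norm R (\<lambda>i. if i \<in> F then x i else 0) = L2_set (\<lambda>i. cmod (x i)) F"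
    using infsumI[OF hs] by (simp add: l2norm_def L2_set_def)
qed

lemma L2_set_sum_le:
  assumes "finite N"
  shows "L2_set (\<lambda>i. \<Sum>n\<in>N. f n i) F \<le> (\<Sum>n\<in>N. L2_set (f n) F)"
  using assms
proof (induction rule: finite_induct)
  case (insert n N)
  have "L2_set (\<lambda>i. \<Sum>n\<in>insert n N. f n i) F = L2_set (\<lambda>i. f n i + (\<Sum>n\<in>N. f n i)) F"
    using insert by simp
  also have "\<dots> \<le> L2_set (f n) F + L2_set (\<lambda>i. \<Sum>n\<in>N. f n i) F"
    by (rule L2_set_triangle_ineq)
  finally show ?case using insert by simp
qed (simp add: L2_set_def)

text \<open>Completeness of \<open>l\<^sup>2(R)\<close>, in the form of convergence of absolutely convergent series.\<close>

lemma l2_suminf: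
  assumes u: "\<And>n. u n \<in> l2 R" and le: "\<And>n. l2norm R (u n) \<le> a n" and a: "summable a"
  shows "\<And>i. summable (\<lambda>n. u n i)" "(\<lambda>i. \<Sum>n. u n i) \<in> l2 R"
    "l2norm R (\<lambda>i. \<Sum>n. u n i) \<le> suminf a"
proof -
  have a0: "0 \<le> a n" for n
    using le[of n] l2norm_nonneg order_trans by blast
  show summ: "summable (\<lambda>n. u n i)" for i
    by (rule summable_comparison_test'[OF a, of 0]) (use cmod_le_l2norm[OF u] le order_trans in blast)
  have "L2_set (\<lambda>i. cmod (\<Sum>n. u n i)) F \<le> suminf a" if F: "finite F" "F \<subseteq> R" for F
  proof (rule LIMSEQ_le_const2)
    show "(\<lambda>N. L2_set (\<lambda>i. cmod (\<Sum>n<N. u n i)) F) \<longlonglongrightarrow> L2_set (\<lambda>i. cmod (\<Sum>n. u n i)) F"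
      unfolding L2_set_def by (intro tendsto_intros summable_LIMSEQ summ)
    have "L2_set (\<lambda>i. cmod (\<Sum>n<N. u n i)) F \<le> suminf a" for N
    proof -
      have "L2_set (\<lambda>i. cmod (\<Sum>n<N. u n i)) F \<le> L2_set (\<lambda>i. \<Sum>n<N. cmod (u n i)) F"
        by (intro L2_set_mono norm_sum) auto
      also have "\<dots> \<le> (\<Sum>n<N. L2_set (\<lambda>i. cmod (u n i)) F)"
        by (rule L2_set_sum_le) auto
      also have "\<dots> \<le> (\<Sum>n<N. a n)"
        using L2_set_le_l2norm[OF u F] le order_trans by (intro sum_mono) blast
      also have "\<dots> \<le> suminf a"
        by (rule sum_le_suminf[OF a]) (auto simp: a0)
      finally show ?thesis .
    qed
    then show "\<exists>N. \<forall>n\<ge>N. L2_set (\<lambda>i. cmod (\<Sum>n<n. u n i)) F \<le> suminf a" by blast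
  qed
  then show "(\<lambda>i. \<Sum>n. u n i) \<in> l2 R" "l2norm R (\<lambda>i. \<Sum>n. u n i) \<le> suminf a"
    using l2_outside[OF u] suminf_nonneg[OF a a0]
    by (intro l2_boundI[of R "\<lambda>i. \<Sum>n. u n i" "suminf a"]; simp)+
qed

section \<open>Bounded nonnegative matrices\<close>

text \<open>
  Boundedness of a nonnegative matrix is tested on finitely supported nonnegative vectors. This
  reduces monotonicity, transposition, products and Hadamard products to finite sums; the lemmas
  below identify it with boundedness of the operator on \<open>l\<^sup>2(R)\<close>.
\<close>

definition mat_bound :: "nat set \<Rightarrow> rmat \<Rightarrow> real \<Rightarrow> bool" where
  "mat_bound R K C \<longleftrightarrow> nonneg_mat R K \<and> 0 \<le> C \<and>
     (\<forall>F G x y. finite F \<longrightarrow> F \<subseteq> R \<longrightarrow> finite G \<longrightarrow> G \<subseteq> R \<longrightarrow> (\<forall>i. 0 \<le> x i) \<longrightarrow> (\<forall>i. 0 \<le> y i) \<longrightarrow>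
        (\<Sum>i\<in>F. \<Sum>j\<in>G. K i j * y i * x j) \<le> C * L2_set y F * L2_set x G)"

lemma mat_boundI:
  assumes "nonneg_mat R K" "0 \<le> C"
    and "\<And>F G x y. finite F \<Longrightarrow> F \<subseteq> R \<Longrightarrow> finite G \<Longrightarrow> G \<subseteq> R \<Longrightarrow> (\<And>i. 0 \<le> x i) \<Longrightarrow> (\<And>i. 0 \<le> y i) \<Longrightarrow>
        (\<Sum>i\<in>F. \<Sum>j\<in>G. K i j * y i * x j) \<le> C * L2_set y F * L2_set x G"
  shows "mat_bound R K C"
  using assms unfolding mat_bound_def by blast

lemma mat_boundD:
  assumes "mat_bound R K C" "finite F" "F \<subseteq> R" "finite G" "G \<subseteq> R" "\<And>i. 0 \<le> x i" "\<And>i. 0 \<le> y i"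
  shows "(\<Sum>i\<in>F. \<Sum>j\<in>G. K i j * y i * x j) \<le> C * L2_set y F * L2_set x G"
  using assms unfolding mat_bound_def by blast

lemma mat_bound_nonneg: "mat_bound R K C \<Longrightarrow> i \<in> R \<Longrightarrow> j \<in> R \<Longrightarrow> 0 \<le> K i j"
  by (simp add: mat_bound_def nonneg_mat_def)

lemma mat_bound_const_nonneg: "mat_bound R K C \<Longrightarrow> 0 \<le> C"
  by (simp add: mat_bound_def)

lemma mat_bound_mono_const:
  assumes "mat_bound R K C" "C \<le> D"
  shows "mat_bound R K D"
proof (rule mat_boundI)
  fix F G and x y :: "nat \<Rightarrow> real"
  assume *: "finite F" "F \<subseteq> R" "finite G" "G \<subseteq> R" "\<And>i. 0 \<le> x i" "\<And>i. 0 \<le> y i"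
  have "(\<Sum>i\<in>F. \<Sum>j\<in>G. K i j * y i * x j) \<le> C * L2_set y F * L2_set x G"
    by (rule mat_boundD[OF assms(1) *])
  also have "\<dots> \<le> D * L2_set y F * L2_set x G"
    using assms(2) by (intro mult_right_mono) auto
  finally show "(\<Sum>i\<in>F. \<Sum>j\<in>G. K i j * y i * x j) \<le> D * L2_set y F * L2_set x G" .
qed (use assms in \<open>auto simp: mat_bound_def\<close>)

lemma mat_bound_mono:
  assumes "mat_bound R L C" "\<And>i j. i \<in> R \<Longrightarrow> j \<in> R \<Longrightarrow> 0 \<le> K i j \<and> K i j \<le> L i j"
  shows "mat_bound R K C"
proof (rule mat_boundI)
  fix F G and x y :: "nat \<Rightarrow> real"
  assume *: "finite F" "F \<subseteq> R" "finite G" "G \<subseteq> R" "\<And>i. 0 \<le> x i" "\<And>i. 0 \<le> y i"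
  have "(\<Sum>i\<in>F. \<Sum>j\<in>G. K i j * y i * x j) \<le> (\<Sum>i\<in>F. \<Sum>j\<in>G. L i j * y i * x j)"
    using * assms(2) subsetD[OF *(2)] subsetD[OF *(4)] by (intro sum_mono mult_right_mono) auto
  also have "\<dots> \<le> C * L2_set y F * L2_set x G"
    by (rule mat_boundD[OF assms(1) *])
  finally show "(\<Sum>i\<in>F. \<Sum>j\<in>G. K i j * y i * x j) \<le> C * L2_set y F * L2_set x G" .
qed (use assms in \<open>auto simp: mat_bound_def nonneg_mat_def\<close>)

lemma mat_bound_scale:
  assumes "mat_bound R K C" "0 \<le> c"
  shows "mat_bound R (\<lambda>i j. c * K i j) (c * C)"
proof (rule mat_boundI)
  fix F G and x y :: "nat \<Rightarrow> real"
  assume *: "finite F" "F \<subseteq> R" "finite G" "G \<subseteq> R" "\<And>i. 0 \<le> x i" "\<And>i. 0 \<le> y i"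
  have "(\<Sum>i\<in>F. \<Sum>j\<in>G. c * K i j * y i * x j) = c * (\<Sum>i\<in>F. \<Sum>j\<in>G. K i j * y i * x j)"
    by (simp add: sum_distrib_left mult_ac)
  also have "\<dots> \<le> c * (C * L2_set y F * L2_set x G)"
    using assms(2) by (intro mult_left_mono mat_boundD[OF assms(1) *])
  finally show "(\<Sum>i\<in>F. \<Sum>j\<in>G. c * K i j * y i * x j) \<le> c * C * L2_set y F * L2_set x G"
    by (simp add: mult_ac)
qed (use assms in \<open>auto simp: mat_bound_def nonneg_mat_def\<close>)

lemma mat_bound_adj:
  assumes "mat_bound R K C"
  shows "mat_bound R (mat_adj K) C"
proof (rule mat_boundI)
  fix F G and x y :: "nat \<Rightarrow> real"
  assume *: "finite F" "F \<subseteq> R" "finite G" "G \<subseteq> R" "\<And>i. 0 \<le> x i" "\<And>i. 0 \<le> y i"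
  have "(\<Sum>i\<in>F. \<Sum>j\<in>G. mat_adj K i j * y i * x j) = (\<Sum>j\<in>G. \<Sum>i\<in>F. K j i * x j * y i)"
    by (subst sum.swap) (simp add: mat_adj_def mult_ac)
  also have "\<dots> \<le> C * L2_set x G * L2_set y F"
    by (rule mat_boundD[OF assms]) (use * in auto)
  finally show "(\<Sum>i\<in>F. \<Sum>j\<in>G. mat_adj K i j * y i * x j) \<le> C * L2_set y F * L2_set x G"
    by (simp add: mult_ac)
qed (use assms in \<open>auto simp: mat_bound_def nonneg_mat_def mat_adj_def\<close>)

lemma mat_bound_entry:
  assumes "mat_bound R K C" "i \<in> R" "j \<in> R"
  shows "K i j \<le> C"
  using mat_boundD[OF assms(1), of "{i}" "{j}" "\<lambda>_. 1" "\<lambda>_. 1"] assms(2,3)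
  by (simp add: L2_set_def)

text \<open>
  Testing against \<open>y = K x\<close> turns the estimate of the bilinear form into one of \<open>K x\<close>.
\<close>

lemma mat_bound_row_sums:
  assumes "mat_bound R K C" "finite F" "F \<subseteq> R" "finite G" "G \<subseteq> R" "\<And>i. 0 \<le> x i"
  shows "L2_set (\<lambda>i. \<Sum>j\<in>G. K i j * x j) F \<le> C * L2_set x G"
proof -
  define w where "w = (\<lambda>i. if i \<in> R then \<Sum>j\<in>G. K i j * x j else 0)"
  have w0: "0 \<le> w i" for i
    using assms mat_bound_nonneg[OF assms(1)]
    by (auto simp: w_def intro!: sum_nonneg mult_nonneg_nonneg)
  have "(L2_set w F)\<^sup>2 = (\<Sum>i\<in>F. (w i)\<^sup>2)"
    by (simp add: L2_set_def sum_nonneg)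
  also have "\<dots> = (\<Sum>i\<in>F. \<Sum>j\<in>G. K i j * w i * x j)"
  proof (rule sum.cong[OF refl])
    fix i assume "i \<in> F"
    then have "w i = (\<Sum>j\<in>G. K i j * x j)" using assms by (auto simp: w_def)
    then have "(w i)\<^sup>2 = w i * (\<Sum>j\<in>G. K i j * x j)" by (simp add: power2_eq_square)
    then show "(w i)\<^sup>2 = (\<Sum>j\<in>G. K i j * w i * x j)"
      by (simp add: sum_distrib_left mult_ac)
  qed
  also have "\<dots> \<le> C * L2_set w F * L2_set x G"
    by (rule mat_boundD[OF assms w0])
  finally have *: "L2_set w F * L2_set w F \<le> (C * L2_set x G) * L2_set w F"
    by (simp add: power2_eq_square mult_ac)
  have "L2_set w F \<le> C * L2_set x G"
  proof (cases "L2_set w F = 0")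
    case False
    then have "0 < L2_set w F" using L2_set_nonneg[of w F] by linarith
    then show ?thesis using * mult_le_cancel_right_pos by blast
  qed (use mat_bound_const_nonneg[OF assms(1)] in simp)
  moreover have "L2_set w F = L2_set (\<lambda>i. \<Sum>j\<in>G. K i j * x j) F"
    using assms by (intro L2_set_cong) (auto simp: w_def)
  ultimately show ?thesis by simp
qed

text \<open>
  The converse of \<open>mat_bound_row_sums\<close>, by the Cauchy--Schwarz inequality.
\<close>

lemma mat_bound_of_row_sums:
  assumes "nonneg_mat R K" "0 \<le> C"
    and "\<And>F G x. finite F \<Longrightarrow> F \<subseteq> R \<Longrightarrow> finite G \<Longrightarrow> G \<subseteq> R \<Longrightarrow> (\<And>i. 0 \<le> x i) \<Longrightarrow>
          L2_set (\<lambda>i. \<Sum>j\<in>G. K i j * x j) F \<le> C * L2_set x G"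
  shows "mat_bound R K C"
proof (rule mat_boundI)
  fix F G and x y :: "nat \<Rightarrow> real"
  assume *: "finite F" "F \<subseteq> R" "finite G" "G \<subseteq> R" "\<And>i. 0 \<le> x i" "\<And>i. 0 \<le> y i"
  have "(\<Sum>i\<in>F. \<Sum>j\<in>G. K i j * y i * x j) = (\<Sum>i\<in>F. y i * (\<Sum>j\<in>G. K i j * x j))"
    by (simp add: sum_distrib_left mult_ac)
  also have "\<dots> \<le> (\<Sum>i\<in>F. \<bar>y i\<bar> * \<bar>\<Sum>j\<in>G. K i j * x j\<bar>)"
    by (intro sum_mono) (metis abs_ge_self abs_mult)
  also have "\<dots> \<le> L2_set y F * L2_set (\<lambda>i. \<Sum>j\<in>G. K i j * x j) F"
    by (rule L2_set_mult_ineq)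
  also have "\<dots> \<le> L2_set y F * (C * L2_set x G)"
    using * by (intro mult_left_mono assms(3)) auto
  finally show "(\<Sum>i\<in>F. \<Sum>j\<in>G. K i j * y i * x j) \<le> C * L2_set y F * L2_set x G"
    by (simp add: mult_ac)
qed (use assms in auto)

lemma mat_bound_row_summable:
  assumes K: "mat_bound R K C" and x: "x \<in> l2 R" and i: "i \<in> R"
  shows "(\<lambda>j. K i j * cmod (x j)) summable_on R"
    and "(\<lambda>j. of_real (K i j) * x j) summable_on R"
    and "cmod (mat_op R K x i) \<le> (\<Sum>\<^sub>\<infinity>j\<in>R. K i j * cmod (x j))"
proof -
  have "(\<Sum>j\<in>G. K i j * cmod (x j)) \<le> C * l2norm R x" if "finite G" "G \<subseteq> R" for G
  proof -
    have "L2_set (\<lambda>i. \<Sum>j\<in>G. K i j * cmod (x j)) {i} \<le> C * L2_set (\<lambda>j. cmod (x j)) G"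
      by (rule mat_bound_row_sums[OF K]) (use i that in auto)
    also have "\<dots> \<le> C * l2norm R x"
      using that by (intro mult_left_mono L2_set_le_l2norm x mat_bound_const_nonneg[OF K])
    finally show ?thesis by (simp add: L2_set_def)
  qed
  then show 1: "(\<lambda>j. K i j * cmod (x j)) summable_on R"
    using mat_bound_nonneg[OF K i]
    by (intro nonneg_bdd_above_summable_on bdd_aboveI2[where M = "C * l2norm R x"]) auto
  have eq: "norm (of_real (K i j) * x j) = K i j * cmod (x j)" if "j \<in> R" for j
    using mat_bound_nonneg[OF K i that] by (simp add: norm_mult)
  have abs: "(\<lambda>j. norm (of_real (K i j) * x j)) summable_on R"
    using 1 by (subst summable_on_cong[OF eq])
  then show "(\<lambda>j. of_real (K i j) * x j) summable_on R"
    by (rule abs_summable_summable)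
  have "(\<Sum>\<^sub>\<infinity>j\<in>R. norm (of_real (K i j) * x j)) = (\<Sum>\<^sub>\<infinity>j\<in>R. K i j * cmod (x j))"
    by (rule infsum_cong[OF eq])
  then show "cmod (mat_op R K x i) \<le> (\<Sum>\<^sub>\<infinity>j\<in>R. K i j * cmod (x j))"
    using norm_infsum_bound[OF abs] i by (simp add: mat_op_def)
qed

text \<open>
  The vector \<open>|K| |x|\<close> lies in \<open>l\<^sup>2(R)\<close>. Besides dominating \<open>K x\<close>, it provides the absolute
  convergence of the double series that occur in products.
\<close>

lemma mat_bound_abs_op:
  assumes K: "mat_bound R K C" and x: "x \<in> l2 R"
  defines "w \<equiv> (\<lambda>i. if i \<in> R then complex_of_real (\<Sum>\<^sub>\<infinity>j\<in>R. K i j * cmod (x j)) else 0)"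
  shows "w \<in> l2 R" and "l2norm R w \<le> C * l2norm R x"
proof -
  have bd: "L2_set (\<lambda>i. cmod (w i)) F \<le> C * l2norm R x" if F: "finite F" "F \<subseteq> R" for F
  proof (rule tendsto_upperbound)
    have "((\<lambda>G. L2_set (\<lambda>i. \<Sum>j\<in>G. K i j * cmod (x j)) F)
        \<longlongrightarrow> L2_set (\<lambda>i. \<Sum>\<^sub>\<infinity>j\<in>R. K i j * cmod (x j)) F) (finite_subsets_at_top R)"
      unfolding L2_set_def
      using F by (intro tendsto_intros infsum_tendsto mat_bound_row_summable(1)[OF K x]) auto
    moreover have "L2_set (\<lambda>i. cmod (w i)) F = L2_set (\<lambda>i. \<Sum>\<^sub>\<infinity>j\<in>R. K i j * cmod (x j)) F"
    proof (intro L2_set_cong refl)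
      fix i assume "i \<in> F"
      then have i: "i \<in> R" using F by auto
      have "0 \<le> (\<Sum>\<^sub>\<infinity>j\<in>R. K i j * cmod (x j))"
        by (intro infsum_nonneg mult_nonneg_nonneg mat_bound_nonneg[OF K i]) auto
      then show "cmod (w i) = (\<Sum>\<^sub>\<infinity>j\<in>R. K i j * cmod (x j))" using i by (simp add: w_def)
    qed
    ultimately show "((\<lambda>G. L2_set (\<lambda>i. \<Sum>j\<in>G. K i j * cmod (x j)) F)
        \<longlongrightarrow> L2_set (\<lambda>i. cmod (w i)) F) (finite_subsets_at_top R)" by simp
    have "L2_set (\<lambda>i. \<Sum>j\<in>G. K i j * cmod (x j)) F \<le> C * l2norm R x" if "finite G" "G \<subseteq> R" for G
    proof -
      have "L2_set (\<lambda>i. \<Sum>j\<in>G. K i j * cmod (x j)) F \<le> C * L2_set (\<lambda>j. cmod (x j)) G"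
        by (rule mat_bound_row_sums[OF K]) (use F that in auto)
      also have "\<dots> \<le> C * l2norm R x"
        using that by (intro mult_left_mono L2_set_le_l2norm x mat_bound_const_nonneg[OF K])
      finally show ?thesis .
    qed
    then show "\<forall>\<^sub>F G in finite_subsets_at_top R.
        L2_set (\<lambda>i. \<Sum>j\<in>G. K i j * cmod (x j)) F \<le> C * l2norm R x"
      by (auto intro!: eventually_finite_subsets_at_top_weakI)
  qed simp
  have out: "w i = 0" if "i \<notin> R" for i using that by (simp add: w_def)
  have C0: "0 \<le> C * l2norm R x" using mat_bound_const_nonneg[OF K] by simp
  show "w \<in> l2 R" "l2norm R w \<le> C * l2norm R x"
    by (rule l2_boundI[OF out C0 bd]; assumption)+
qed

lemma
  assumes K: "mat_bound R K C" and x: "x \<in> l2 R"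
  shows mat_bound_op_in_l2: "mat_op R K x \<in> l2 R"
    and mat_bound_op_norm: "l2norm R (mat_op R K x) \<le> C * l2norm R x"
proof -
  let ?w = "\<lambda>i. if i \<in> R then complex_of_real (\<Sum>\<^sub>\<infinity>j\<in>R. K i j * cmod (x j)) else 0"
  have bd: "L2_set (\<lambda>i. cmod (mat_op R K x i)) F \<le> C * l2norm R x" if F: "finite F" "F \<subseteq> R" for F
  proof -
    have "cmod (mat_op R K x i) \<le> cmod (?w i)" if "i \<in> F" for i
      using mat_bound_row_summable(3)[OF K x, of i] that F by auto
    then have "L2_set (\<lambda>i. cmod (mat_op R K x i)) F \<le> L2_set (\<lambda>i. cmod (?w i)) F"
      by (intro L2_set_mono) auto
    also have "\<dots> \<le> l2norm R ?w"
      using mat_bound_abs_op(1)[OF K x] F by (rule L2_set_le_l2norm)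
    also have "\<dots> \<le> C * l2norm R x"
      by (rule mat_bound_abs_op(2)[OF K x])
    finally show ?thesis .
  qed
  have out: "mat_op R K x i = 0" if "i \<notin> R" for i using that by (simp add: mat_op_def)
  have C0: "0 \<le> C * l2norm R x" using mat_bound_const_nonneg[OF K] by simp
  show "mat_op R K x \<in> l2 R" "l2norm R (mat_op R K x) \<le> C * l2norm R x"
    by (rule l2_boundI[OF out C0 bd]; assumption)+
qed

lemma mat_bound_defines_operator: "mat_bound R K C \<Longrightarrow> defines_operator R K"
  unfolding defines_operator_def
  using mat_bound_row_summable(2) mat_bound_op_in_l2 by blast

lemma mat_bound_norm_le:
  assumes K: "mat_bound R K C"
  shows "mat_norm R K \<le> C"
  unfolding mat_norm_def operator_norm_def
proof (rule cSup_least)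
  have "l2norm R (\<lambda>i. 0) \<le> 1" by (simp add: l2norm_def)
  then show "{l2norm R (mat_op R K x) |x. x \<in> l2 R \<and> l2norm R x \<le> 1} \<noteq> {}"
    using zero_in_l2 by blast
  fix a assume "a \<in> {l2norm R (mat_op R K x) |x. x \<in> l2 R \<and> l2norm R x \<le> 1}"
  then obtain x where x: "x \<in> l2 R" "l2norm R x \<le> 1" "a = l2norm R (mat_op R K x)" by blast
  have "a \<le> C * l2norm R x" using mat_bound_op_norm[OF K x(1)] x by simp
  also have "\<dots> \<le> C" using x mat_bound_const_nonneg[OF K] by (simp add: mult_left_le)
  finally show "a \<le> C" .
qed

text \<open>
  A gliding hump: if the bilinear form of \<open>K\<close> were unbounded, unit vectors \<open>x\<^sub>n\<close>, \<open>y\<^sub>n\<close> with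
  \<open>\<langle>K x\<^sub>n, y\<^sub>n\<rangle> \<ge> 4\<^sup>n\<close> would exist. All being nonnegative, \<open>x = \<Sum>\<^sub>n 2\<^sup>-\<^sup>n x\<^sub>n\<close> has \<open>\<parallel>K x\<parallel> \<ge> 2\<^sup>n\<close>
  for all \<open>n\<close>.
\<close>

lemma defines_operator_mat_bound:
  assumes nn: "nonneg_mat R K" and op: "defines_operator R K"
  shows "\<exists>C. mat_bound R K C"
proof (rule ccontr)
  assume neg: "\<nexists>C. mat_bound R K C"
  define P where "P n F G x y \<longleftrightarrow> finite F \<and> F \<subseteq> R \<and> finite G \<and> G \<subseteq> R \<and>
    (\<forall>i. 0 \<le> x i) \<and> (\<forall>i. 0 \<le> y i) \<and> L2_set y F = 1 \<and> L2_set x G = 1 \<and>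
    4 ^ n \<le> (\<Sum>i\<in>F. \<Sum>j\<in>G. K i j * y i * x j)" for n F G and x y :: "nat \<Rightarrow> real"
  have "\<exists>F G x y. P n F G x y" for n
  proof -
    have "\<not> mat_bound R K (4 ^ n)" using neg by blast
    then obtain F G x y where *: "finite F" "F \<subseteq> R" "finite G" "G \<subseteq> R"
        "\<forall>i. 0 \<le> x i" "\<forall>i. 0 \<le> y i"
        "4 ^ n * L2_set y F * L2_set x G < (\<Sum>i\<in>F. \<Sum>j\<in>G. K i j * y i * x j)"
      using nn unfolding mat_bound_def by (auto simp: not_le)
    have y: "L2_set y F > 0"
    proof (rule ccontr)
      assume "\<not> L2_set y F > 0"
      then have 0: "L2_set y F = 0" using L2_set_nonneg[of y F] by linarith
      then have "\<forall>i\<in>F. y i = 0" using L2_set_eq_0_iff[OF *(1)] by blast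
      then show False using * 0 by simp
    qed
    have x: "L2_set x G > 0"
    proof (rule ccontr)
      assume "\<not> L2_set x G > 0"
      then have 0: "L2_set x G = 0" using L2_set_nonneg[of x G] by linarith
      then have "\<forall>i\<in>G. x i = 0" using L2_set_eq_0_iff[OF *(3)] by blast
      then show False using * 0 by simp
    qed
    have "(\<Sum>i\<in>F. \<Sum>j\<in>G. K i j * (y i / L2_set y F) * (x j / L2_set x G)) =
        (\<Sum>i\<in>F. \<Sum>j\<in>G. K i j * y i * x j) / (L2_set y F * L2_set x G)"
      by (simp add: sum_divide_distrib)
    moreover have "4 ^ n \<le> \<dots>"
      using * x y by (simp add: field_simps)
    moreover have "L2_set (\<lambda>i. y i / L2_set y F) F = 1" "L2_set (\<lambda>i. x i / L2_set x G) G = 1"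
      using x y L2_set_left_distrib[of "1 / L2_set y F" y F]
        L2_set_left_distrib[of "1 / L2_set x G" x G] by auto
    ultimately have "P n F G (\<lambda>i. x i / L2_set x G) (\<lambda>i. y i / L2_set y F)"
      using * by (simp add: P_def)
    then show ?thesis by blast
  qed
  then obtain F G x y where P: "\<And>n. P n (F n) (G n) (x n) (y n)" by metis
  define u where "u n i = (if i \<in> G n then of_real ((1/2) ^ n * x n i) else 0 :: complex)" for n i
  have u_l2: "u n \<in> l2 R" for n
    unfolding u_def using finite_support_in_l2 P by (auto simp: P_def)
  have u_norm: "l2norm R (u n) \<le> (1/2) ^ n" for n
  proof -
    have "l2norm R (u n) = L2_set (\<lambda>i. (1/2) ^ n * x n i) (G n)"
      unfolding u_def using P[of n]
      by (subst l2norm_finite_support) (auto simp: P_def norm_mult norm_power intro!: L2_set_cong)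
    also have "\<dots> = (1/2) ^ n * L2_set (x n) (G n)"
      by (rule L2_set_right_distrib[symmetric]) simp
    finally show ?thesis using P[of n] by (simp add: P_def)
  qed
  define v where "v = (\<lambda>i. \<Sum>n. u n i)"
  have summ: "summable (\<lambda>n. u n i)" for i
    by (rule l2_suminf[OF u_l2 u_norm]) (simp add: summable_geometric)
  have v_l2: "v \<in> l2 R"
    unfolding v_def by (rule l2_suminf[OF u_l2 u_norm]) (simp add: summable_geometric)
  define \<xi> where "\<xi> n i = (if i \<in> G n then (1/2) ^ n * x n i else 0)" for n i
  have \<xi>0: "0 \<le> \<xi> n i" for n i using P[of n] by (simp add: \<xi>_def P_def)
  have u\<xi>: "u n i = of_real (\<xi> n i)" for n i by (simp add: u_def \<xi>_def)
  have summ\<xi>: "summable (\<lambda>n. \<xi> n i)" for i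
    using summ[of i] unfolding u\<xi> by (simp add: summable_complex_of_real)
  have v_eq: "v i = of_real (\<Sum>n. \<xi> n i)" for i
    unfolding v_def u\<xi> by (rule suminf_of_real[OF summ\<xi>, symmetric])
  have v_ge: "\<xi> n i \<le> (\<Sum>n. \<xi> n i)" for n i
    using sum_le_suminf[OF summ\<xi>, of "{n}" i] \<xi>0 by simp
  have Kv: "mat_op R K v \<in> l2 R" using op v_l2 by (simp add: defines_operator_def)
  have "2 ^ n \<le> l2norm R (mat_op R K v)" for n
  proof -
    have fin: "finite (F n)" "F n \<subseteq> R" "finite (G n)" "G n \<subseteq> R" and y0: "0 \<le> y n i" for i
      using P[of n] by (auto simp: P_def)
    have row: "(\<Sum>j\<in>G n. K i j * ((1/2) ^ n * x n j)) \<le> cmod (mat_op R K v i)" if "i \<in> F n" for i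
    proof -
      have i: "i \<in> R" using that fin by auto
      have K0: "0 \<le> K i j" if "j \<in> R" for j using nn i that by (simp add: nonneg_mat_def)
      have "(\<lambda>j. complex_of_real (K i j) * v j) summable_on R"
        using op v_l2 i by (simp add: defines_operator_def)
      then have "(\<lambda>j. complex_of_real (K i j * (\<Sum>n. \<xi> n j))) summable_on R"
        by (simp add: v_eq)
      then have sm: "(\<lambda>j. K i j * (\<Sum>n. \<xi> n j)) summable_on R"
        using summable_on_Re by fastforce
      have "(\<Sum>j\<in>G n. K i j * ((1/2) ^ n * x n j)) = (\<Sum>j\<in>G n. K i j * \<xi> n j)"
        by (simp add: \<xi>_def)
      also have "\<dots> \<le> (\<Sum>j\<in>G n. K i j * (\<Sum>n. \<xi> n j))"
        using v_ge[of n] fin K0 by (intro sum_mono mult_left_mono) auto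
      also have "\<dots> \<le> (\<Sum>\<^sub>\<infinity>j\<in>R. K i j * (\<Sum>n. \<xi> n j))"
        using fin K0 \<xi>0
        by (intro finite_sum_le_infsum[OF sm]) (auto intro!: mult_nonneg_nonneg suminf_nonneg summ\<xi>)
      also have "\<dots> = Re (mat_op R K v i)"
      proof -
        have "((\<lambda>j. complex_of_real (K i j * (\<Sum>n. \<xi> n j))) has_sum
            of_real (\<Sum>\<^sub>\<infinity>j\<in>R. K i j * (\<Sum>n. \<xi> n j))) R"
          by (intro has_sum_of_real has_sum_infsum sm)
        from infsumI[OF this] show ?thesis
          using i by (simp add: mat_op_def v_eq)
      qed
      also have "\<dots> \<le> cmod (mat_op R K v i)" by (rule complex_Re_le_cmod)
      finally show ?thesis .
    qed
    have "4 ^ n * (1/2) ^ n \<le> (\<Sum>i\<in>F n. \<Sum>j\<in>G n. K i j * y n i * x n j) * (1/2) ^ n"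
      using P[of n] by (intro mult_right_mono) (auto simp: P_def)
    also have "\<dots> = (\<Sum>i\<in>F n. y n i * (\<Sum>j\<in>G n. K i j * ((1/2) ^ n * x n j)))"
      by (simp add: sum_distrib_left sum_distrib_right mult_ac)
    also have "\<dots> \<le> (\<Sum>i\<in>F n. \<bar>y n i\<bar> * \<bar>cmod (mat_op R K v i)\<bar>)"
      using row y0 by (intro sum_mono) (auto intro!: mult_left_mono)
    also have "\<dots> \<le> L2_set (y n) (F n) * L2_set (\<lambda>i. cmod (mat_op R K v i)) (F n)"
      by (rule L2_set_mult_ineq)
    also have "\<dots> \<le> l2norm R (mat_op R K v)"
      using P[of n] L2_set_le_l2norm[OF Kv fin(1,2)] by (simp add: P_def)
    finally show ?thesis by (simp flip: power_mult_distrib)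
  qed
  moreover obtain n where "l2norm R (mat_op R K v) < 2 ^ n"
    using real_arch_pow[of 2 "l2norm R (mat_op R K v)"] by auto
  ultimately show False by (metis not_le)
qed

section \<open>Products of bounded nonnegative matrices\<close>

lemma mat_bound_cong:
  assumes "mat_bound R K C" "\<And>i j. i \<in> R \<Longrightarrow> j \<in> R \<Longrightarrow> L i j = K i j"
  shows "mat_bound R L C"
  using mat_bound_mono[OF assms(1), of L] assms mat_bound_nonneg[OF assms(1)] by simp

lemma mat_times_cong:
  assumes "\<And>k. k \<in> R \<Longrightarrow> K i k = K' i k" "\<And>k. k \<in> R \<Longrightarrow> L k j = L' k j"
  shows "mat_times R K L i j = mat_times R K' L' i j"
  using assms by (auto simp: mat_times_def intro!: infsum_cong)

lemma
  assumes K: "mat_bound R K C" and L: "mat_bound R L D"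
  shows mat_times_summable:
      "\<And>i j. i \<in> R \<Longrightarrow> j \<in> R \<Longrightarrow> (\<lambda>k. K i k * L k j) summable_on R"
    and mat_bound_times: "mat_bound R (mat_times R K L) (C * D)"
proof -
  have C0: "0 \<le> C" and D0: "0 \<le> D"
    using K L by (simp_all add: mat_bound_const_nonneg)
  \<comment> \<open>The estimate with the inner summation restricted to a finite set \<open>E\<close> is Cauchy--Schwarz.\<close>
  have fin: "(\<Sum>i\<in>F. \<Sum>j\<in>G. (\<Sum>k\<in>E. K i k * L k j) * y i * x j) \<le> C * D * L2_set y F * L2_set x G"
    if *: "finite F" "F \<subseteq> R" "finite G" "G \<subseteq> R" "finite E" "E \<subseteq> R"
      "\<And>i. 0 \<le> x i" "\<And>i. 0 \<le> y i"
    for E F G and x y :: "nat \<Rightarrow> real"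
  proof -
    have "(\<Sum>i\<in>F. \<Sum>j\<in>G. (\<Sum>k\<in>E. K i k * L k j) * y i * x j) =
        (\<Sum>i\<in>F. \<Sum>j\<in>G. \<Sum>k\<in>E. (K i k * y i) * (L k j * x j))"
      by (simp add: sum_distrib_left sum_distrib_right mult_ac)
    also have "\<dots> = (\<Sum>i\<in>F. \<Sum>k\<in>E. \<Sum>j\<in>G. (K i k * y i) * (L k j * x j))"
      by (intro sum.cong refl sum.swap)
    also have "\<dots> = (\<Sum>k\<in>E. \<Sum>i\<in>F. \<Sum>j\<in>G. (K i k * y i) * (L k j * x j))"
      by (rule sum.swap)
    also have "\<dots> = (\<Sum>k\<in>E. (\<Sum>i\<in>F. K i k * y i) * (\<Sum>j\<in>G. L k j * x j))"
      by (simp add: sum_product)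
    also have "\<dots> \<le> (\<Sum>k\<in>E. \<bar>\<Sum>i\<in>F. mat_adj K k i * y i\<bar> * \<bar>\<Sum>j\<in>G. L k j * x j\<bar>)"
      unfolding mat_adj_def by (intro sum_mono) (metis abs_ge_self abs_mult)
    also have "\<dots> \<le> L2_set (\<lambda>k. \<Sum>i\<in>F. mat_adj K k i * y i) E * L2_set (\<lambda>k. \<Sum>j\<in>G. L k j * x j) E"
      by (rule L2_set_mult_ineq)
    also have "\<dots> \<le> (C * L2_set y F) * (D * L2_set x G)"
      using * C0 by (intro mult_mono mat_bound_row_sums[OF L] mat_bound_row_sums[OF mat_bound_adj[OF K]])
        auto
    finally show ?thesis by (simp add: mult_ac)
  qed
  have nn: "0 \<le> K i k * L k j" if "i \<in> R" "k \<in> R" "j \<in> R" for i j k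
    using that K L by (simp add: mat_bound_nonneg)
  show summ: "(\<lambda>k. K i k * L k j) summable_on R" if ij: "i \<in> R" "j \<in> R" for i j
  proof (rule nonneg_bdd_above_summable_on)
    have "(\<Sum>k\<in>E. K i k * L k j) \<le> C * D" if "finite E" "E \<subseteq> R" for E
      using fin[of "{i}" "{j}" E "\<lambda>_. 1" "\<lambda>_. 1"] that ij by (simp add: L2_set_def)
    then show "bdd_above (sum (\<lambda>k. K i k * L k j) ` {F. F \<subseteq> R \<and> finite F})"
      by (intro bdd_aboveI2[where M = "C * D"]) auto
  qed (use nn ij in auto)
  show "mat_bound R (mat_times R K L) (C * D)"
  proof (rule mat_boundI)
    fix F G and x y :: "nat \<Rightarrow> real"
    assume *: "finite F" "F \<subseteq> R" "finite G" "G \<subseteq> R" "\<And>i. 0 \<le> x i" "\<And>i. 0 \<le> y i"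
    have "((\<lambda>E. \<Sum>i\<in>F. \<Sum>j\<in>G. (\<Sum>k\<in>E. K i k * L k j) * y i * x j) \<longlongrightarrow>
        (\<Sum>i\<in>F. \<Sum>j\<in>G. mat_times R K L i j * y i * x j)) (finite_subsets_at_top R)"
      unfolding mat_times_def
      using subsetD[OF *(2)] subsetD[OF *(4)] by (intro tendsto_intros infsum_tendsto summ)
    then show "(\<Sum>i\<in>F. \<Sum>j\<in>G. mat_times R K L i j * y i * x j) \<le> C * D * L2_set y F * L2_set x G"
      by (rule tendsto_upperbound)
        (auto intro!: eventually_finite_subsets_at_top_weakI fin *)
  next
    show "nonneg_mat R (mat_times R K L)"
      using nn by (auto simp: nonneg_mat_def mat_times_def intro!: infsum_nonneg)
  qed (use C0 D0 in simp)
qed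

lemma mat_times_mono:
  assumes K: "mat_bound R K' C" and L: "mat_bound R L' D" and ij: "i \<in> R" "j \<in> R"
    and "\<And>k. k \<in> R \<Longrightarrow> 0 \<le> K i k \<and> K i k \<le> K' i k" "\<And>k. k \<in> R \<Longrightarrow> 0 \<le> L k j \<and> L k j \<le> L' k j"
  shows "mat_times R K L i j \<le> mat_times R K' L' i j"
proof -
  have le: "K i k * L k j \<le> K' i k * L' k j" if "k \<in> R" for k
    using that assms(5,6) by (intro mult_mono) (auto intro: order_trans)
  note summ = mat_times_summable[OF K L ij]
  have "(\<lambda>k. K i k * L k j) summable_on R"
    by (rule summable_on_comparison_test[OF summ le]) (use assms(5,6) in auto)
  then show ?thesis
    unfolding mat_times_def by (intro infsum_mono summ le)
qed

text \<open>
  The matrix product represents the composition of operators: for \<open>x \<in> l\<^sup>2(R)\<close> the double series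
  \<open>\<Sum>\<^sub>k\<^sub>,\<^sub>j K\<^sub>i\<^sub>k L\<^sub>k\<^sub>j x\<^sub>j\<close> converges absolutely, because \<open>|L| |x| \<in> l\<^sup>2(R)\<close>.
\<close>

lemma mat_op_times:
  assumes K: "mat_bound R K C" and L: "mat_bound R L D" and x: "x \<in> l2 R"
  shows "mat_op R (mat_times R K L) x = mat_op R K (mat_op R L x)"
proof
  fix i
  show "mat_op R (mat_times R K L) x i = mat_op R K (mat_op R L x) i"
  proof (cases "i \<in> R")
    case i: True
    define f where "f k j = of_real (K i k) * (of_real (L k j) * x j)" for k j
    define w where "w k = (if k \<in> R then complex_of_real (\<Sum>\<^sub>\<infinity>j\<in>R. L k j * cmod (x j)) else 0)" for k
    have w: "w \<in> l2 R"
      using mat_bound_abs_op(1)[OF L x] unfolding w_def .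
    have K0: "0 \<le> K i k" if "k \<in> R" for k using mat_bound_nonneg[OF K i that] .
    have w0: "cmod (w k) = (\<Sum>\<^sub>\<infinity>j\<in>R. L k j * cmod (x j))" if "k \<in> R" for k
    proof -
      have "0 \<le> (\<Sum>\<^sub>\<infinity>j\<in>R. L k j * cmod (x j))"
        by (intro infsum_nonneg mult_nonneg_nonneg mat_bound_nonneg[OF L that]) auto
      then show ?thesis using that by (simp add: w_def)
    qed
    have norm_f: "norm (f k j) = K i k * (L k j * cmod (x j))" if "k \<in> R" "j \<in> R" for k j
      using K0[OF that(1)] mat_bound_nonneg[OF L that] by (simp add: f_def norm_mult)
    have inner: "(\<lambda>j. norm (f k j)) summable_on R" if "k \<in> R" for k
    proof -
      have "(\<lambda>j. norm (f k j)) summable_on R \<longleftrightarrow> (\<lambda>j. K i k * (L k j * cmod (x j))) summable_on R"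
        by (rule summable_on_cong) (rule norm_f[OF that])
      then show ?thesis
        using mat_bound_row_summable(1)[OF L x that] summable_on_cmult_right by blast
    qed
    have sum_inner: "(\<Sum>\<^sub>\<infinity>j\<in>R. norm (f k j)) = K i k * cmod (w k)" if "k \<in> R" for k
    proof -
      have "(\<Sum>\<^sub>\<infinity>j\<in>R. norm (f k j)) = (\<Sum>\<^sub>\<infinity>j\<in>R. K i k * (L k j * cmod (x j)))"
        by (rule infsum_cong) (rule norm_f[OF that])
      then show ?thesis by (simp add: infsum_cmult_right' w0[OF that])
    qed
    have outer: "(\<lambda>k. norm (\<Sum>\<^sub>\<infinity>j\<in>R. norm (f k j))) summable_on R"
    proof -
      have "(\<lambda>k. norm (\<Sum>\<^sub>\<infinity>j\<in>R. norm (f k j))) summable_on R \<longleftrightarrow>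
          (\<lambda>k. K i k * cmod (w k)) summable_on R"
        by (rule summable_on_cong) (use sum_inner K0 in simp)
      then show ?thesis using mat_bound_row_summable(1)[OF K w i] by simp
    qed
    have "(\<lambda>p. norm ((\<lambda>(k, j). f k j) p)) summable_on (SIGMA k:R. R)"
      by (rule Infinite_Sum.abs_summable_on_Sigma_iff[THEN iffD2]) (use inner outer in simp)
    then have prod: "(\<lambda>(k, j). f k j) summable_on R \<times> R"
      by (rule abs_summable_summable)
    have "mat_op R K (mat_op R L x) i = (\<Sum>\<^sub>\<infinity>k\<in>R. \<Sum>\<^sub>\<infinity>j\<in>R. f k j)"
      using i by (auto simp: mat_op_def f_def infsum_cmult_right' intro!: infsum_cong)
    also have "\<dots> = (\<Sum>\<^sub>\<infinity>j\<in>R. \<Sum>\<^sub>\<infinity>k\<in>R. f k j)"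
      by (rule infsum_swap_banach[OF prod])
    also have "\<dots> = (\<Sum>\<^sub>\<infinity>j\<in>R. of_real (mat_times R K L i j) * x j)"
    proof (rule infsum_cong)
      fix j assume j: "j \<in> R"
      have "(\<Sum>\<^sub>\<infinity>k\<in>R. f k j) = (\<Sum>\<^sub>\<infinity>k\<in>R. of_real (K i k * L k j) * x j)"
        by (simp add: f_def mult_ac)
      also have "\<dots> = (\<Sum>\<^sub>\<infinity>k\<in>R. of_real (K i k * L k j)) * x j"
        by (rule infsum_cmult_left')
      also have "(\<Sum>\<^sub>\<infinity>k\<in>R. complex_of_real (K i k * L k j)) = of_real (mat_times R K L i j)"
        unfolding mat_times_def
        by (rule infsumI, rule has_sum_of_real, rule has_sum_infsum, rule mat_times_summable[OF K L i j])
      finally show "(\<Sum>\<^sub>\<infinity>k\<in>R. f k j) = of_real (mat_times R K L i j) * x j" .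
    qed
    finally show ?thesis using i by (simp add: mat_op_def)
  qed (simp add: mat_op_def)
qed

definition unit_vec :: "nat \<Rightarrow> nat \<Rightarrow> complex" where
  "unit_vec j = (\<lambda>i. if i = j then 1 else 0)"

lemma unit_vec_in_l2: "j \<in> R \<Longrightarrow> unit_vec j \<in> l2 R"
  using finite_support_in_l2[of "{j}" R "\<lambda>_. 1"] by (simp add: unit_vec_def)

lemma infsum_delta:
  fixes f :: "nat \<Rightarrow> 'a :: {comm_monoid_add, t2_space}"
  assumes "j \<in> R" "\<And>k. k \<noteq> j \<Longrightarrow> f k = 0"
  shows "(\<Sum>\<^sub>\<infinity>k\<in>R. f k) = f j"
  using infsum_cong_neutral[of R "{j}" f f] assms by auto

lemma mat_op_unit_vec:
  assumes "i \<in> R" "j \<in> R"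
  shows "mat_op R K (unit_vec j) i = of_real (K i j)"
  using assms by (simp add: mat_op_def unit_vec_def infsum_delta[of j])

text \<open>
  Identities between matrix products are proved for operators, where associativity is free, and
  transferred back to the entries in \<open>R \<times> R\<close> by evaluation at the unit vectors.
\<close>

lemma mat_op_inject:
  assumes "\<And>x. x \<in> l2 R \<Longrightarrow> mat_op R K x = mat_op R L x" "i \<in> R" "j \<in> R"
  shows "K i j = L i j"
  using assms(1)[OF unit_vec_in_l2[OF assms(3)]] mat_op_unit_vec[OF assms(2,3), of K]
    mat_op_unit_vec[OF assms(2,3), of L] by simp

lemma mat_op_one: "x \<in> l2 R \<Longrightarrow> mat_op R mat_one x = x"
proof
  fix i assume x: "x \<in> l2 R"
  show "mat_op R mat_one x i = x i"
    using infsum_delta[of i R "\<lambda>j. of_real (mat_one i j) * x j"] l2_outside[OF x]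
    by (auto simp: mat_op_def mat_one_def)
qed

lemma mat_bound_one: "mat_bound R mat_one 1"
proof (rule mat_bound_of_row_sums)
  fix F G and x :: "nat \<Rightarrow> real"
  assume *: "finite F" "F \<subseteq> R" "finite G" "G \<subseteq> R" "\<And>i. 0 \<le> x i"
  have "L2_set (\<lambda>i. \<Sum>j\<in>G. mat_one i j * x j) F = L2_set (\<lambda>i. if i \<in> G then x i else 0) F"
    using *(3) by (intro L2_set_cong) (auto simp: mat_one_def if_distrib[of "\<lambda>c. c * _"] sum.delta cong: if_cong)
  also have "\<dots> \<le> L2_set x G"
    unfolding L2_set_def using * by (auto intro!: sum_mono2 simp: if_distrib[of power2] sum.If_cases cong: if_cong)
  finally show "L2_set (\<lambda>i. \<Sum>j\<in>G. mat_one i j * x j) F \<le> 1 * L2_set x G" by simp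
qed (auto simp: nonneg_mat_def mat_one_def)

definition bounded_mat :: "nat set \<Rightarrow> rmat \<Rightarrow> bool" where
  "bounded_mat R K \<longleftrightarrow> (\<exists>C. mat_bound R K C)"

lemma bounded_mat_iff: "bounded_mat R K \<longleftrightarrow> nonneg_mat R K \<and> defines_operator R K"
proof
  assume "bounded_mat R K"
  then obtain C where C: "mat_bound R K C" unfolding bounded_mat_def by blast
  then have "nonneg_mat R K" by (simp add: mat_bound_def)
  with mat_bound_defines_operator[OF C] show "nonneg_mat R K \<and> defines_operator R K" by simp
qed (use defines_operator_mat_bound in \<open>simp add: bounded_mat_def\<close>)

lemma bounded_mat_times: "bounded_mat R K \<Longrightarrow> bounded_mat R L \<Longrightarrow> bounded_mat R (mat_times R K L)"
  unfolding bounded_mat_def using mat_bound_times by blast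

lemma bounded_mat_adj: "bounded_mat R K \<Longrightarrow> bounded_mat R (mat_adj K)"
  unfolding bounded_mat_def using mat_bound_adj by blast

lemma mat_op_in_l2: "bounded_mat R K \<Longrightarrow> x \<in> l2 R \<Longrightarrow> mat_op R K x \<in> l2 R"
  unfolding bounded_mat_def using mat_bound_op_in_l2 by blast

lemma mat_prod_list_Nil [simp]: "mat_prod_list R [] = mat_one"
  and mat_prod_list_Cons [simp]:
    "mat_prod_list R (K # Ks) = mat_times R K (mat_prod_list R Ks)"
  by (simp_all add: mat_prod_list_def)

lemma bounded_mat_prod_list:
  "(\<And>K. K \<in> set Ks \<Longrightarrow> bounded_mat R K) \<Longrightarrow> bounded_mat R (mat_prod_list R Ks)"
proof (induction Ks)
  case Nil
  show ?case using mat_bound_one by (auto simp: bounded_mat_def)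
qed (simp add: bounded_mat_times)

lemma mat_op_prod_list:
  assumes "\<And>K. K \<in> set Ks \<Longrightarrow> bounded_mat R K" "x \<in> l2 R"
  shows "mat_op R (mat_prod_list R Ks) x = foldr (mat_op R) Ks x"
  using assms
proof (induction Ks)
  case (Cons K Ks)
  have "bounded_mat R K" "bounded_mat R (mat_prod_list R Ks)"
    using Cons.prems by (auto intro: bounded_mat_prod_list)
  then obtain C D where "mat_bound R K C" "mat_bound R (mat_prod_list R Ks) D"
    by (metis bounded_mat_def)
  then show ?case using Cons by (simp add: mat_op_times)
qed (simp add: mat_op_one)

lemma foldr_mat_op_in_l2:
  "(\<And>K. K \<in> set Ks \<Longrightarrow> bounded_mat R K) \<Longrightarrow> x \<in> l2 R \<Longrightarrow> foldr (mat_op R) Ks x \<in> l2 R"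
  by (induction Ks) (simp_all add: mat_op_in_l2)

lemma mat_prod_list_cong:
  "list_all2 (\<lambda>K L. \<forall>i\<in>R. \<forall>j\<in>R. K i j = L i j) Ks Ls \<Longrightarrow> i \<in> R \<Longrightarrow> j \<in> R \<Longrightarrow>
    mat_prod_list R Ks i j = mat_prod_list R Ls i j"
proof (induction Ks Ls arbitrary: i rule: list_all2_induct)
  case (Cons K Ks L Ls)
  have "mat_times R K (mat_prod_list R Ks) i j = mat_times R L (mat_prod_list R Ls) i j"
    using Cons by (intro mat_times_cong) auto
  then show ?case by simp
qed simp

lemma mat_prod_list_append:
  assumes "\<And>K. K \<in> set Ks \<union> set Ls \<Longrightarrow> bounded_mat R K" "i \<in> R" "j \<in> R"
  shows "mat_prod_list R (Ks @ Ls) i j = mat_times R (mat_prod_list R Ks) (mat_prod_list R Ls) i j"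
proof (rule mat_op_inject[OF _ assms(2,3)])
  fix x assume x: "x \<in> l2 R"
  have "bounded_mat R (mat_prod_list R Ks)" "bounded_mat R (mat_prod_list R Ls)"
    using assms(1) by (simp_all add: bounded_mat_prod_list)
  then obtain C D where CD: "mat_bound R (mat_prod_list R Ks) C" "mat_bound R (mat_prod_list R Ls) D"
    by (auto simp: bounded_mat_def)
  show "mat_op R (mat_prod_list R (Ks @ Ls)) x =
      mat_op R (mat_times R (mat_prod_list R Ks) (mat_prod_list R Ls)) x"
    using assms(1) x mat_op_prod_list[of "Ks @ Ls" R x]
    by (simp add: mat_op_times[OF CD x] mat_op_prod_list foldr_mat_op_in_l2)
qed

lemma mat_prod_list_singleton:
  assumes "j \<in> R"
  shows "mat_prod_list R [K] i j = K i j"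
  using infsum_delta[OF assms, of "\<lambda>k. K i k * mat_one k j"]
  by (simp add: mat_times_def mat_one_def)

lemma mat_prod_list_concat:
  assumes "\<And>Ks K. Ks \<in> set Kss \<Longrightarrow> K \<in> set Ks \<Longrightarrow> bounded_mat R K" "i \<in> R" "j \<in> R"
  shows "mat_prod_list R (concat Kss) i j = mat_prod_list R (map (mat_prod_list R) Kss) i j"
  using assms
proof (induction Kss arbitrary: i)
  case (Cons Ks Kss)
  have "mat_prod_list R (concat (Ks # Kss)) i j =
      mat_times R (mat_prod_list R Ks) (mat_prod_list R (concat Kss)) i j"
    using Cons.prems mat_prod_list_append[of Ks "concat Kss" R i j] by fastforce
  also have "\<dots> = mat_times R (mat_prod_list R Ks) (mat_prod_list R (map (mat_prod_list R) Kss)) i j"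
    using Cons by (intro mat_times_cong) auto
  finally show ?case by simp
qed simp

lemma mat_times_adj:
  "mat_times R (mat_adj K) (mat_adj L) = mat_adj (mat_times R L K)"
  by (simp add: mat_times_def mat_adj_def mult_ac)

lemma mat_prod_list_rev_adj:
  assumes "\<And>K. K \<in> set Ks \<Longrightarrow> bounded_mat R K" "i \<in> R" "j \<in> R"
  shows "mat_prod_list R (rev (map mat_adj Ks)) i j = mat_prod_list R Ks j i"
  using assms
proof (induction Ks arbitrary: i j)
  case (Cons K Ks)
  have "mat_prod_list R (rev (map mat_adj (K # Ks))) i j =
      mat_times R (mat_prod_list R (rev (map mat_adj Ks))) (mat_prod_list R [mat_adj K]) i j"
    using Cons.prems mat_prod_list_append[of "rev (map mat_adj Ks)" "[mat_adj K]" R i j]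
    by (auto intro: bounded_mat_adj)
  also have "\<dots> = mat_times R (mat_adj (mat_prod_list R Ks)) (mat_adj K) i j"
  proof (rule mat_times_cong)
    fix k assume k: "k \<in> R"
    show "mat_prod_list R (rev (map mat_adj Ks)) i k = mat_adj (mat_prod_list R Ks) i k"
      using Cons k by (simp add: mat_adj_def[of "mat_prod_list R Ks"])
    show "mat_prod_list R [mat_adj K] k j = mat_adj K k j"
      by (rule mat_prod_list_singleton[OF Cons.prems(3)])
  qed
  also have "\<dots> = mat_prod_list R (K # Ks) j i"
    unfolding mat_times_adj by (simp add: mat_adj_def)
  finally show ?case .
qed (simp add: mat_one_def)

lemma mat_prod_list_mono:
  assumes "length Ks = length Ls"
    and "\<And>n i j. n < length Ls \<Longrightarrow> i \<in> R \<Longrightarrow> j \<in> R \<Longrightarrow> 0 \<le> (Ks ! n) i j \<and> (Ks ! n) i j \<le> (Ls ! n) i j"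
    and "\<And>L. L \<in> set Ls \<Longrightarrow> bounded_mat R L" and "i \<in> R" "j \<in> R"
  shows "0 \<le> mat_prod_list R Ks i j \<and> mat_prod_list R Ks i j \<le> mat_prod_list R Ls i j"
  using assms
proof (induction Ks Ls arbitrary: i rule: list_induct2)
  case Nil
  then show ?case by (simp add: mat_one_def)
next
  case (Cons K Ks L Ls)
  have K: "0 \<le> K i j \<and> K i j \<le> L i j" if "i \<in> R" "j \<in> R" for i j
    using Cons.prems(1)[of 0] that by simp
  have IH: "0 \<le> mat_prod_list R Ks i j \<and> mat_prod_list R Ks i j \<le> mat_prod_list R Ls i j" if "i \<in> R" for i
    using Cons.IH[of i] Cons.prems(1)[of "Suc _"] Cons.prems(2) \<open>j \<in> R\<close> that by simp
  have "bounded_mat R L" "bounded_mat R (mat_prod_list R Ls)"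
    using Cons.prems(2) by (simp_all add: bounded_mat_prod_list)
  then obtain C D where CD: "mat_bound R L C" "mat_bound R (mat_prod_list R Ls) D"
    by (auto simp: bounded_mat_def)
  have "0 \<le> mat_times R K (mat_prod_list R Ks) i j"
    unfolding mat_times_def using K IH Cons.prems by (intro infsum_nonneg mult_nonneg_nonneg) auto
  moreover have "mat_times R K (mat_prod_list R Ks) i j \<le> mat_times R L (mat_prod_list R Ls) i j"
    using K IH Cons.prems by (intro mat_times_mono[OF CD]) auto
  ultimately show ?case by simp
qed

section \<open>Growth of the powers\<close>

definition mat_pow :: "nat set \<Rightarrow> rmat \<Rightarrow> nat \<Rightarrow> rmat" where
  "mat_pow R K n = mat_prod_list R (replicate n K)"

lemma mat_pow_0 [simp]: "mat_pow R K 0 = mat_one"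
  and mat_pow_Suc [simp]: "mat_pow R K (Suc n) = mat_times R K (mat_pow R K n)"
  by (simp_all add: mat_pow_def)

lemma mat_pow_1: "j \<in> R \<Longrightarrow> mat_pow R K (Suc 0) i j = K i j"
  using mat_prod_list_singleton[of j R K i] by simp

lemma bounded_mat_pow: "bounded_mat R K \<Longrightarrow> bounded_mat R (mat_pow R K n)"
  unfolding mat_pow_def by (rule bounded_mat_prod_list) simp

lemma mat_pow_add:
  assumes "bounded_mat R K" "i \<in> R" "j \<in> R"
  shows "mat_pow R K (m + n) i j = mat_times R (mat_pow R K m) (mat_pow R K n) i j"
  unfolding mat_pow_def replicate_add
  by (rule mat_prod_list_append) (use assms in auto)

lemma concat_replicate_replicate: "concat (replicate n (replicate p x)) = replicate (p * n) x"
  by (induction n) (simp_all add: replicate_add)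

lemma mat_pow_pow:
  assumes "bounded_mat R K" "i \<in> R" "j \<in> R"
  shows "mat_pow R (mat_pow R K p) n i j = mat_pow R K (p * n) i j"
  using mat_prod_list_concat[of "replicate n (replicate p K)" R i j] assms
  by (auto simp: concat_replicate_replicate mat_pow_def map_replicate)

lemma mat_pow_adj:
  assumes "bounded_mat R K" "i \<in> R" "j \<in> R"
  shows "mat_pow R (mat_adj K) n i j = mat_pow R K n j i"
  using mat_prod_list_rev_adj[of "replicate n K" R i j] assms
  by (auto simp: mat_pow_def map_replicate)

lemma mat_op_pow:
  assumes "bounded_mat R K" "x \<in> l2 R"
  shows "mat_op R (mat_pow R K n) x = (mat_op R K ^^ n) x"
  unfolding mat_pow_def using mat_op_prod_list[of "replicate n K" R x] assms by simp

lemma mat_op_iterate_in_l2: "bounded_mat R K \<Longrightarrow> x \<in> l2 R \<Longrightarrow> (mat_op R K ^^ n) x \<in> l2 R"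
  by (induction n) (simp_all add: mat_op_in_l2)

text \<open>
  For bounded \<open>K\<close>, the infimum of all such \<open>s > 0\<close> is \<open>lim \<parallel>K\<^sup>n\<parallel>\<^sup>1\<^sup>/\<^sup>n\<close>. The constant \<open>C\<close> absorbs
  the bounded factors that arise when powers are regrouped.
\<close>

definition growth :: "nat set \<Rightarrow> rmat \<Rightarrow> real \<Rightarrow> bool" where
  "growth R K s \<longleftrightarrow> (\<exists>C. \<forall>n. mat_bound R (mat_pow R K n) (C * s ^ n))"

lemma mat_bound_pow:
  assumes "mat_bound R K C"
  shows "mat_bound R (mat_pow R K n) (C ^ n)"
  by (induction n) (simp_all add: mat_bound_one mat_bound_times[OF assms])

lemma mat_bound_growth: "mat_bound R K C \<Longrightarrow> growth R K C"
  unfolding growth_def using mat_bound_pow[of R K C] by (intro exI[of _ 1]) simp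

lemma growth_const_nonneg:
  assumes "\<forall>n. mat_bound R (mat_pow R K n) (C * s ^ n)"
  shows "0 \<le> C"
  using mat_bound_const_nonneg[of R "mat_pow R K 0" "C * s ^ 0"] assms by (metis mult_1_right power_0)

lemma growth_mono_rate:
  assumes "growth R K s" "0 \<le> s" "s \<le> t"
  shows "growth R K t"
proof -
  obtain C where C: "\<forall>n. mat_bound R (mat_pow R K n) (C * s ^ n)"
    using assms(1) unfolding growth_def by blast
  have "mat_bound R (mat_pow R K n) (C * t ^ n)" for n
    by (rule mat_bound_mono_const[OF C[rule_format]])
      (intro mult_left_mono power_mono growth_const_nonneg[OF C] assms)
  then show ?thesis unfolding growth_def by blast
qed

lemma growth_mono:
  assumes "bounded_mat R L" "\<And>i j. i \<in> R \<Longrightarrow> j \<in> R \<Longrightarrow> 0 \<le> K i j \<and> K i j \<le> L i j" "growth R L s"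
  shows "growth R K s"
proof -
  obtain C where C: "\<forall>n. mat_bound R (mat_pow R L n) (C * s ^ n)"
    using assms(3) unfolding growth_def by blast
  have "0 \<le> mat_pow R K n i j \<and> mat_pow R K n i j \<le> mat_pow R L n i j" if "i \<in> R" "j \<in> R" for n i j
    unfolding mat_pow_def by (rule mat_prod_list_mono) (use assms that in auto)
  then have "mat_bound R (mat_pow R K n) (C * s ^ n)" for n
    by (intro mat_bound_mono[OF C[rule_format]])
  then show ?thesis unfolding growth_def by blast
qed

lemma growth_adj:
  assumes "bounded_mat R K" "growth R K s"
  shows "growth R (mat_adj K) s"
proof -
  obtain C where C: "\<forall>n. mat_bound R (mat_pow R K n) (C * s ^ n)"
    using assms(2) unfolding growth_def by blast
  have "mat_bound R (mat_pow R (mat_adj K) n) (C * s ^ n)" for n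
    by (rule mat_bound_cong[OF mat_bound_adj[OF C[rule_format]]])
      (simp add: mat_pow_adj[OF assms(1)] mat_adj_def[of "mat_pow R K n"])
  then show ?thesis unfolding growth_def by blast
qed

text \<open>Division with remainder of the exponent by \<open>p\<close> recovers the growth of \<open>K\<close> from that of \<open>K\<^sup>p\<close>.\<close>

lemma growth_root:
  assumes K: "bounded_mat R K" and p: "p > 0" and t: "t > 0" and gr: "growth R (mat_pow R K p) (t ^ p)"
  shows "growth R K t"
proof -
  obtain C where C: "\<forall>n. mat_bound R (mat_pow R (mat_pow R K p) n) (C * (t ^ p) ^ n)"
    using gr unfolding growth_def by blast
  obtain D where D: "mat_bound R K D" using K unfolding bounded_mat_def by blast
  have C0: "0 \<le> C" by (rule growth_const_nonneg[OF C])
  have D0: "0 \<le> D" by (rule mat_bound_const_nonneg[OF D])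
  \<comment> \<open>The maximum makes \<open>M \<ge> 1\<close>, so that \<open>M\<^sup>r \<le> M\<^sup>p\<close> for the remainder \<open>r\<close>.\<close>
  define M where "M = max 1 (D / t)"
  have "mat_bound R (mat_pow R K n) (C * M ^ p * t ^ n)" for n
  proof -
    define q r where "q = n div p" and "r = n mod p"
    have n: "n = p * q + r" by (simp add: q_def r_def)
    have r: "r \<le> p" using p by (simp add: r_def)
    have "D ^ r = (D / t) ^ r * t ^ r" using t by (simp flip: power_mult_distrib)
    also have "\<dots> \<le> M ^ r * t ^ r"
      using t D0 by (intro mult_right_mono power_mono) (auto simp: M_def)
    also have "\<dots> \<le> M ^ p * t ^ r"
      using t r by (intro mult_right_mono power_increasing) (auto simp: M_def)
    finally have Dr: "D ^ r \<le> M ^ p * t ^ r" .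
    have "mat_bound R (mat_pow R K (p * q)) (C * (t ^ p) ^ q)"
      by (rule mat_bound_cong[OF C[rule_format]]) (simp add: mat_pow_pow[OF K])
    from mat_bound_times[OF this mat_bound_pow[OF D, of r]]
    have "mat_bound R (mat_pow R K n) (C * (t ^ p) ^ q * D ^ r)"
      unfolding n by (rule mat_bound_cong) (simp add: mat_pow_add[OF K])
    then show ?thesis
    proof (rule mat_bound_mono_const)
      have "C * (t ^ p) ^ q * D ^ r \<le> C * (t ^ p) ^ q * (M ^ p * t ^ r)"
        using C0 t Dr by (intro mult_left_mono) auto
      also have "\<dots> = C * M ^ p * t ^ n" by (simp add: n power_add power_mult)
      finally show "C * (t ^ p) ^ q * D ^ r \<le> C * M ^ p * t ^ n" .
    qed
  qed
  then show ?thesis unfolding growth_def by blast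
qed

lemma Cons_concat_replicate:
  "concat (replicate (Suc n) [y, x]) = [y] @ concat (replicate n [x, y]) @ [x]"
  by (induction n) auto

lemma mat_pow_times:
  assumes "bounded_mat R X" "bounded_mat R Y" "i \<in> R" "j \<in> R"
  shows "mat_pow R (mat_times R X Y) n i j = mat_prod_list R (concat (replicate n [X, Y])) i j"
proof -
  have "mat_prod_list R (concat (replicate n [X, Y])) i j =
      mat_prod_list R (map (mat_prod_list R) (replicate n [X, Y])) i j"
    using assms by (intro mat_prod_list_concat) auto
  also have "\<dots> = mat_prod_list R (replicate n (mat_times R X Y)) i j"
  proof (rule mat_prod_list_cong)
    have "mat_prod_list R [X, Y] i j = mat_times R X Y i j" if "i \<in> R" "j \<in> R" for i j
      using mat_prod_list_singleton[OF that(2), of Y]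
        mat_times_cong[of R X i X "mat_prod_list R [Y]" j Y] by simp
    then show "list_all2 (\<lambda>K L. \<forall>i\<in>R. \<forall>j\<in>R. K i j = L i j)
        (map (mat_prod_list R) (replicate n [X, Y])) (replicate n (mat_times R X Y))"
      by (auto simp: list_all2_conv_all_nth)
  qed (use assms in auto)
  finally show ?thesis by (simp add: mat_pow_def)
qed

text \<open>
  The powers satisfy \<open>(YX)\<^sup>n\<^sup>+\<^sup>1 = Y (XY)\<^sup>n X\<close>, so that those of \<open>YX\<close> grow at most as fast as those
  of \<open>XY\<close>.
\<close>

lemma growth_times_commute:
  assumes X: "bounded_mat R X" and Y: "bounded_mat R Y" and s: "s > 0"
    and gr: "growth R (mat_times R X Y) s"
  shows "growth R (mat_times R Y X) s"
proof -
  obtain C where C: "\<forall>n. mat_bound R (mat_pow R (mat_times R X Y) n) (C * s ^ n)"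
    using gr unfolding growth_def by blast
  obtain D E where D: "mat_bound R X D" and E: "mat_bound R Y E"
    using X Y unfolding bounded_mat_def by blast
  note C0 = growth_const_nonneg[OF C] and D0 = mat_bound_const_nonneg[OF D]
    and E0 = mat_bound_const_nonneg[OF E]
  define M where "M = max 1 (E * C * D / s)"
  have "mat_bound R (mat_pow R (mat_times R Y X) n) (M * s ^ n)" for n
  proof (cases n)
    case 0
    show ?thesis by (rule mat_bound_mono_const[of _ _ 1]) (simp_all add: 0 mat_bound_one M_def)
  next
    case (Suc n)
    let ?P = "mat_prod_list R (concat (replicate n [X, Y]))"
    have bd: "K \<in> set (concat (replicate n [X, Y])) \<Longrightarrow> bounded_mat R K" for K
      using X Y by (auto split: if_splits)
    have P: "mat_bound R ?P (C * s ^ n)"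
      by (rule mat_bound_cong[OF C[rule_format]]) (simp add: mat_pow_times[OF X Y])
    have "mat_bound R (mat_times R Y (mat_times R ?P X)) (E * (C * s ^ n * D))"
      by (intro mat_bound_times E P D)
    then have "mat_bound R (mat_pow R (mat_times R Y X) (Suc n)) (E * (C * s ^ n * D))"
    proof (rule mat_bound_cong)
      fix i j assume ij: "i \<in> R" "j \<in> R"
      have eq: "mat_prod_list R (concat (replicate n [X, Y]) @ [X]) k j = mat_times R ?P X k j"
        if k: "k \<in> R" for k
      proof -
        have "mat_prod_list R (concat (replicate n [X, Y]) @ [X]) k j =
            mat_times R ?P (mat_prod_list R [X]) k j"
          by (rule mat_prod_list_append) (use bd X k ij in auto)
        also have "\<dots> = mat_times R ?P X k j"
          by (rule mat_times_cong) (use mat_prod_list_singleton[OF ij(2), of X] in auto)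
        finally show ?thesis .
      qed
      have "mat_pow R (mat_times R Y X) (Suc n) i j =
          mat_times R Y (mat_prod_list R (concat (replicate n [X, Y]) @ [X])) i j"
        unfolding mat_pow_times[OF Y X ij] Cons_concat_replicate by simp
      also have "\<dots> = mat_times R Y (mat_times R ?P X) i j"
        by (rule mat_times_cong) (simp_all add: eq)
      finally show "mat_pow R (mat_times R Y X) (Suc n) i j = mat_times R Y (mat_times R ?P X) i j" .
    qed
    then show ?thesis unfolding Suc
    proof (rule mat_bound_mono_const)
      have "E * (C * s ^ n * D) = (E * C * D / s) * s ^ Suc n" using s by simp
      also have "\<dots> \<le> M * s ^ Suc n"
        using s by (intro mult_right_mono) (auto simp: M_def)
      finally show "E * (C * s ^ n * D) \<le> M * s ^ Suc n" .
    qed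
  qed
  then show ?thesis unfolding growth_def by blast
qed

section \<open>The spectral radius of a nonnegative matrix\<close>

lemma mat_op_add:
  assumes K: "bounded_mat R K" and "x \<in> l2 R" "y \<in> l2 R"
  shows "mat_op R K (\<lambda>i. x i + y i) = (\<lambda>i. mat_op R K x i + mat_op R K y i)"
proof
  fix i
  obtain C where C: "mat_bound R K C" using K unfolding bounded_mat_def by blast
  show "mat_op R K (\<lambda>i. x i + y i) i = mat_op R K x i + mat_op R K y i"
    using mat_bound_row_summable(2)[OF C assms(2)] mat_bound_row_summable(2)[OF C assms(3)]
    by (simp add: mat_op_def ring_distribs infsum_add)
qed

lemma mat_op_scale: "mat_op R K (\<lambda>i. c * x i) = (\<lambda>i. c * mat_op R K x i)"
proof
  fix i
  have "(\<Sum>\<^sub>\<infinity>j\<in>R. complex_of_real (K i j) * (c * x j)) = (\<Sum>\<^sub>\<infinity>j\<in>R. c * (of_real (K i j) * x j))"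
    by (simp add: mult_ac)
  then show "mat_op R K (\<lambda>i. c * x i) i = c * mat_op R K x i"
    by (simp add: mat_op_def infsum_cmult_right')
qed

lemma mat_op_iterate_add:
  assumes K: "bounded_mat R K" and "x \<in> l2 R" "y \<in> l2 R"
  shows "(mat_op R K ^^ n) (\<lambda>i. x i + y i) = (\<lambda>i. (mat_op R K ^^ n) x i + (mat_op R K ^^ n) y i)"
  by (induction n) (simp_all add: mat_op_add[OF K] mat_op_iterate_in_l2[OF K] assms)

lemma mat_op_iterate_scale:
  "(mat_op R K ^^ n) (\<lambda>i. c * x i) = (\<lambda>i. c * (mat_op R K ^^ n) x i)"
  by (induction n) (simp_all add: mat_op_scale)

definition neumann :: "nat set \<Rightarrow> rmat \<Rightarrow> complex \<Rightarrow> (nat \<Rightarrow> complex) \<Rightarrow> nat \<Rightarrow> complex" where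
  "neumann R K z x = (\<lambda>i. \<Sum>n. (mat_op R K ^^ n) x i / z ^ Suc n)"

context
  fixes R K s z
  assumes K: "bounded_mat R K" and gr: "growth R K s" and s: "0 \<le> s" "s < cmod z"
begin

text \<open>
  The series is dominated by a geometric series of ratio \<open>s / |z| < 1\<close> in \<open>l\<^sup>2(R)\<close>. One constant
  serves for the series and for the iterates.
\<close>

lemma neumann_norm:
  obtains C where "\<And>x i. x \<in> l2 R \<Longrightarrow> summable (\<lambda>n. (mat_op R K ^^ n) x i / z ^ Suc n)"
    and "\<And>x. x \<in> l2 R \<Longrightarrow> neumann R K z x \<in> l2 R"
    and "\<And>x. x \<in> l2 R \<Longrightarrow> l2norm R (neumann R K z x) \<le> C * l2norm R x"
    and "\<And>x n. x \<in> l2 R \<Longrightarrow> l2norm R ((mat_op R K ^^ n) x) \<le> C * s ^ n * l2norm R x"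
    and "0 \<le> C"
proof -
  obtain C where C: "\<forall>n. mat_bound R (mat_pow R K n) (C * s ^ n)"
    using gr unfolding growth_def by blast
  have C0: "0 \<le> C" by (rule growth_const_nonneg[OF C])
  have it: "l2norm R ((mat_op R K ^^ n) x) \<le> C * s ^ n * l2norm R x" if "x \<in> l2 R" for x n
    using mat_bound_op_norm[OF C[rule_format] that] mat_op_pow[OF K that, of n] by metis
  define a where "a x n = C * l2norm R x / cmod z * (s / cmod z) ^ n" for x n
  have z: "cmod z > 0" using s by linarith
  have q: "norm (s / cmod z) < 1" using s z by simp
  have a_sums: "a x sums (C * l2norm R x / cmod z * (1 / (1 - s / cmod z)))" for x
    unfolding a_def by (intro sums_mult geometric_sums q)
  define u where "u x n = (\<lambda>i. (mat_op R K ^^ n) x i / z ^ Suc n)" for x n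
  have u_l2: "u x n \<in> l2 R" if "x \<in> l2 R" for x n
    using l2_scale[OF mat_op_iterate_in_l2[OF K that, of n], of "1 / z ^ Suc n"]
    by (simp add: u_def)
  have u_norm: "l2norm R (u x n) \<le> a x n" if "x \<in> l2 R" for x n
  proof -
    have "l2norm R (u x n) = l2norm R ((mat_op R K ^^ n) x) / cmod z ^ Suc n"
      using l2norm_scale[of R "1 / z ^ Suc n" "(mat_op R K ^^ n) x"]
      by (simp add: u_def norm_divide norm_power norm_mult)
    also have "\<dots> \<le> C * s ^ n * l2norm R x / cmod z ^ Suc n"
      by (intro divide_right_mono it[OF that]) simp
    also have "\<dots> = a x n" by (simp add: a_def power_divide)
    finally show ?thesis .
  qed
  have neu: "neumann R K z x = (\<lambda>i. \<Sum>n. u x n i)" for x by (simp add: neumann_def u_def)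
  define c where "c = C / cmod z * (1 / (1 - s / cmod z))"
  have c0: "0 \<le> c"
    unfolding c_def using C0 z s by (intro mult_nonneg_nonneg divide_nonneg_nonneg) auto
  have sum_a: "suminf (a x) = c * l2norm R x" for x
    using sums_unique[OF a_sums[of x]] by (simp add: c_def)
  show thesis
  proof (rule that[of "max C c"])
    fix x assume x: "x \<in> l2 R"
    note * = l2_suminf[OF u_l2[OF x] u_norm[OF x] sums_summable[OF a_sums]]
    show "summable (\<lambda>n. (mat_op R K ^^ n) x i / z ^ Suc n)" for i
      using *(1) unfolding u_def .
    show "neumann R K z x \<in> l2 R" using *(2) unfolding neu .
    have "l2norm R (neumann R K z x) \<le> c * l2norm R x" using *(3) unfolding neu sum_a .
    also have "\<dots> \<le> max C c * l2norm R x" by (intro mult_right_mono) auto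
    finally show "l2norm R (neumann R K z x) \<le> max C c * l2norm R x" .
    fix n
    have "l2norm R ((mat_op R K ^^ n) x) \<le> C * s ^ n * l2norm R x" by (rule it[OF x])
    also have "\<dots> \<le> max C c * s ^ n * l2norm R x" using s by (intro mult_right_mono) auto
    finally show "l2norm R ((mat_op R K ^^ n) x) \<le> max C c * s ^ n * l2norm R x" .
  qed (use C0 in simp)
qed

lemma neumann_summable: "x \<in> l2 R \<Longrightarrow> summable (\<lambda>n. (mat_op R K ^^ n) x i / z ^ Suc n)"
  by (rule neumann_norm) auto

lemma neumann_in_l2: "x \<in> l2 R \<Longrightarrow> neumann R K z x \<in> l2 R"
  by (rule neumann_norm) auto

lemma neumann_add:
  assumes "x \<in> l2 R" "y \<in> l2 R"
  shows "neumann R K z (\<lambda>i. x i + y i) = (\<lambda>i. neumann R K z x i + neumann R K z y i)"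
  unfolding neumann_def mat_op_iterate_add[OF K assms]
  by (simp add: add_divide_distrib suminf_add neumann_summable[OF assms(1)] neumann_summable[OF assms(2)]
      del: power_Suc)

lemma neumann_scale:
  assumes "x \<in> l2 R"
  shows "neumann R K z (\<lambda>i. c * x i) = (\<lambda>i. c * neumann R K z x i)"
  unfolding neumann_def mat_op_iterate_scale
  using suminf_mult[OF neumann_summable[OF assms], of c] by (simp del: power_Suc)

lemma neumann_bounded: "bounded_operator R (neumann R K z)"
proof -
  obtain C where "\<And>x. x \<in> l2 R \<Longrightarrow> l2norm R (neumann R K z x) \<le> C * l2norm R x"
    by (rule neumann_norm) auto
  then have "\<exists>C. \<forall>x\<in>l2 R. l2norm R (neumann R K z x) \<le> C * l2norm R x" by auto
  then show ?thesis
    unfolding bounded_operator_def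
    by (intro conjI ballI allI neumann_in_l2 neumann_add neumann_scale)
qed

lemma neumann_step:
  assumes x: "x \<in> l2 R"
  shows "z * neumann R K z x i = x i + neumann R K z (mat_op R K x) i"
proof -
  let ?u = "\<lambda>n. (mat_op R K ^^ n) x i"
  have z0: "z \<noteq> 0" using s by auto
  have "(\<lambda>n. z * (?u n / z ^ Suc n)) \<longlonglongrightarrow> z * 0"
    by (intro tendsto_intros summable_LIMSEQ_zero neumann_summable[OF x])
  then have "(\<lambda>n. ?u n / z ^ n) \<longlonglongrightarrow> 0" using z0 by simp
  from telescope_sums'[OF this]
  have "(\<lambda>n. ?u n / z ^ n - ?u (Suc n) / z ^ Suc n) sums x i" by simp
  moreover have "(\<lambda>n. ?u n / z ^ n - ?u (Suc n) / z ^ Suc n) =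
      (\<lambda>n. z * (?u n / z ^ Suc n) - (mat_op R K ^^ n) (mat_op R K x) i / z ^ Suc n)"
  proof
    fix n
    have "(mat_op R K ^^ Suc n) x = (mat_op R K ^^ n) (mat_op R K x)"
      by (simp add: funpow_swap1)
    then show "?u n / z ^ n - ?u (Suc n) / z ^ Suc n =
        z * (?u n / z ^ Suc n) - (mat_op R K ^^ n) (mat_op R K x) i / z ^ Suc n"
      using z0 by simp
  qed
  ultimately have "(\<lambda>n. z * (?u n / z ^ Suc n) - (mat_op R K ^^ n) (mat_op R K x) i / z ^ Suc n)
      sums x i" by simp
  moreover have "(\<lambda>n. z * (?u n / z ^ Suc n) - (mat_op R K ^^ n) (mat_op R K x) i / z ^ Suc n)
      sums (z * neumann R K z x i - neumann R K z (mat_op R K x) i)"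
    unfolding neumann_def
    by (intro sums_diff sums_mult summable_sums neumann_summable x mat_op_in_l2[OF K])
  ultimately have "x i = z * neumann R K z x i - neumann R K z (mat_op R K x) i"
    by (rule sums_unique2)
  then show ?thesis by simp
qed

text \<open>
  The commutator \<open>E = [K, N]\<close> with the Neumann series \<open>N\<close> satisfies \<open>z E = E K\<close> by the recursion
  for \<open>N\<close>. Hence \<open>E = z\<^sup>-\<^sup>n E K\<^sup>n\<close>, which tends to \<open>0\<close>.
\<close>

lemma neumann_commute:
  assumes x: "x \<in> l2 R"
  shows "mat_op R K (neumann R K z x) = neumann R K z (mat_op R K x)"
proof
  fix i
  let ?T = "mat_op R K" and ?N = "neumann R K z"
  define E where "E y i = ?T (?N y) i - ?N (?T y) i" for y i
  have step: "z * E y i = E (?T y) i" if y: "y \<in> l2 R" for y i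
  proof -
    note [simp] = mat_op_in_l2[OF K] neumann_in_l2
    have "(\<lambda>i. z * ?N y i) = (\<lambda>i. y i + ?N (?T y) i)"
      using neumann_step[OF y] by auto
    then have "?T (\<lambda>i. z * ?N y i) = ?T (\<lambda>i. y i + ?N (?T y) i)" by simp
    then have "(\<lambda>i. z * ?T (?N y) i) = (\<lambda>i. ?T y i + ?T (?N (?T y)) i)"
      using y by (simp add: mat_op_scale mat_op_add[OF K])
    then have 1: "z * ?T (?N y) i = ?T y i + ?T (?N (?T y)) i" by (rule fun_cong)
    have 2: "z * ?N (?T y) i = ?T y i + ?N (?T (?T y)) i"
      using neumann_step[of "?T y" i] y by simp
    show ?thesis unfolding E_def using 1 2 by (simp add: algebra_simps)
  qed
  obtain C where C: "\<And>x. x \<in> l2 R \<Longrightarrow> l2norm R (?N x) \<le> C * l2norm R x"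
     "\<And>x n. x \<in> l2 R \<Longrightarrow> l2norm R ((?T ^^ n) x) \<le> C * s ^ n * l2norm R x" "0 \<le> C"
    by (rule neumann_norm) (rule that; assumption)
  obtain D where D: "mat_bound R K D" using K unfolding bounded_mat_def by blast
  have D0: "0 \<le> D" by (rule mat_bound_const_nonneg[OF D])
  have Ebound: "cmod (E y i) \<le> 2 * D * C * l2norm R y" if y: "y \<in> l2 R" for y
  proof -
    have "cmod (?T (?N y) i) \<le> D * (C * l2norm R y)"
      using cmod_le_l2norm[OF mat_op_in_l2[OF K neumann_in_l2[OF y]], of i]
        mat_bound_op_norm[OF D neumann_in_l2[OF y]] mult_left_mono[OF C(1)[OF y] D0] by linarith
    moreover have "cmod (?N (?T y) i) \<le> C * (D * l2norm R y)"
      using cmod_le_l2norm[OF neumann_in_l2[OF mat_op_in_l2[OF K y]], of i]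
        C(1)[OF mat_op_in_l2[OF K y]] mult_left_mono[OF mat_bound_op_norm[OF D y] C(3)] by linarith
    ultimately show ?thesis
      unfolding E_def using norm_triangle_ineq4[of "?T (?N y) i" "?N (?T y) i"]
      by (simp add: mult_ac)
  qed
  have Eit: "z ^ n * E x i = E ((?T ^^ n) x) i" for n
  proof (induction n)
    case (Suc n)
    have "z ^ Suc n * E x i = z * E ((?T ^^ n) x) i" using Suc by (simp add: mult.assoc)
    also have "\<dots> = E ((?T ^^ Suc n) x) i" using step[OF mat_op_iterate_in_l2[OF K x]] by simp
    finally show ?case .
  qed simp
  have z: "cmod z > 0" using s by linarith
  have le: "cmod (E x i) \<le> 2 * D * C * (C * l2norm R x) * (s / cmod z) ^ n" for n
  proof -
    have "cmod z ^ n * cmod (E x i) = cmod (E ((?T ^^ n) x) i)"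
      using Eit[of n] by (metis norm_mult norm_power)
    also have "\<dots> \<le> 2 * D * C * l2norm R ((?T ^^ n) x)"
      by (rule Ebound[OF mat_op_iterate_in_l2[OF K x]])
    also have "\<dots> \<le> 2 * D * C * (C * s ^ n * l2norm R x)"
      using D0 C by (intro mult_left_mono C(2) x) auto
    finally have "cmod z ^ n * cmod (E x i) \<le> 2 * D * C * (C * s ^ n * l2norm R x)" .
    then show ?thesis using z by (simp add: power_divide field_simps)
  qed
  have "(\<lambda>n. 2 * D * C * (C * l2norm R x) * (s / cmod z) ^ n) \<longlonglongrightarrow> 2 * D * C * (C * l2norm R x) * 0"
    using s z by (intro tendsto_intros LIMSEQ_power_zero) simp
  then have "cmod (E x i) \<le> 2 * D * C * (C * l2norm R x) * 0"
    by (rule LIMSEQ_le_const) (use le in blast)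
  then show "?T (?N x) i = ?N (?T x) i" by (simp add: E_def)
qed

lemma neumann_inverse:
  assumes x: "x \<in> l2 R"
  shows "neumann R K z (\<lambda>i. z * x i - mat_op R K x i) = x"
    and "(\<lambda>i. z * neumann R K z x i - mat_op R K (neumann R K z x) i) = x"
proof -
  have T: "mat_op R K x \<in> l2 R" by (rule mat_op_in_l2[OF K x])
  have "neumann R K z (\<lambda>i. z * x i + (-1) * mat_op R K x i) =
      (\<lambda>i. z * neumann R K z x i + (-1) * neumann R K z (mat_op R K x) i)"
    using neumann_add[OF l2_scale[OF x] l2_scale[OF T], of z "-1"] neumann_scale[OF x]
      neumann_scale[OF T, of "-1"] by simp
  then show "neumann R K z (\<lambda>i. z * x i - mat_op R K x i) = x"
    by (simp add: neumann_step[OF x])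
  show "(\<lambda>i. z * neumann R K z x i - mat_op R K (neumann R K z x) i) = x"
    by (simp add: neumann_commute[OF x] neumann_step[OF x])
qed

lemma not_in_spectrum: "z \<notin> operator_spectrum R (mat_op R K)"
  unfolding operator_spectrum_def using neumann_bounded neumann_inverse by blast

end

lemma spectrum_norm_le:
  assumes "bounded_mat R K" "growth R K s" "0 \<le> s" "z \<in> operator_spectrum R (mat_op R K)"
  shows "cmod z \<le> s"
  using not_in_spectrum[OF assms(1-3)] assms(4) by (meson not_le)

lemma mat_bound_tendsto:
  assumes lim: "(f \<longlongrightarrow> c) F" and ev: "eventually (\<lambda>s. mat_bound R K (f s)) F" and F: "F \<noteq> bot"
  shows "mat_bound R K c"
proof (rule mat_boundI)
  obtain s where "mat_bound R K (f s)" using eventually_happens[OF ev] F by auto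
  then show "nonneg_mat R K" by (simp add: mat_bound_def)
  show "0 \<le> c"
    by (rule tendsto_lowerbound[OF lim _ F]) (use ev in \<open>auto elim: eventually_mono simp: mat_bound_def\<close>)
next
  fix G H and x y :: "nat \<Rightarrow> real"
  assume *: "finite G" "G \<subseteq> R" "finite H" "H \<subseteq> R" "\<And>i. 0 \<le> x i" "\<And>i. 0 \<le> y i"
  show "(\<Sum>i\<in>G. \<Sum>j\<in>H. K i j * y i * x j) \<le> c * L2_set y G * L2_set x H"
  proof (rule tendsto_lowerbound[OF _ _ F])
    show "((\<lambda>s. f s * L2_set y G * L2_set x H) \<longlongrightarrow> c * L2_set y G * L2_set x H) F"
      by (intro tendsto_intros lim)
    show "\<forall>\<^sub>F s in F. (\<Sum>i\<in>G. \<Sum>j\<in>H. K i j * y i * x j) \<le> f s * L2_set y G * L2_set x H"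
      using ev by (rule eventually_mono) (use mat_boundD * in blast)
  qed
qed

text \<open>
  The matrix of the Neumann series at a positive real \<open>s\<close>. It is nonnegative, and its entries
  dominate each of their summands.
\<close>

definition resolvent_mat :: "nat set \<Rightarrow> rmat \<Rightarrow> real \<Rightarrow> rmat" where
  "resolvent_mat R K s = (\<lambda>i j. \<Sum>n. mat_pow R K n i j / s ^ Suc n)"

lemma resolvent_mat_summable:
  assumes K: "bounded_mat R K" and gr: "growth R K t" and t: "0 \<le> t" "t < s" and ij: "i \<in> R" "j \<in> R"
  shows "summable (\<lambda>n. mat_pow R K n i j / s ^ Suc n)"
proof -
  obtain C where C: "\<forall>n. mat_bound R (mat_pow R K n) (C * t ^ n)"
    using gr unfolding growth_def by blast
  have "summable (\<lambda>n. C / s * (t / s) ^ n)"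
    using t by (intro summable_mult summable_geometric) auto
  then show ?thesis
  proof (rule summable_comparison_test')
    fix n
    have "0 \<le> mat_pow R K n i j" "mat_pow R K n i j \<le> C * t ^ n"
      using mat_bound_nonneg[OF C[rule_format] ij] mat_bound_entry[OF C[rule_format] ij] by auto
    then have "norm (mat_pow R K n i j / s ^ Suc n) \<le> C * t ^ n / s ^ Suc n"
      using t by (simp add: divide_right_mono)
    then show "norm (mat_pow R K n i j / s ^ Suc n) \<le> C / s * (t / s) ^ n"
      using t by (simp add: power_divide)
  qed
qed

text \<open>
  If \<open>B\<close> is a left inverse of \<open>s\<^sub>0 - K\<close> of norm at most \<open>\<beta>\<close>, then the resolvent at \<open>s\<close> near \<open>s\<^sub>0\<close>
  satisfies \<open>y = B (x - (s - s\<^sub>0) y)\<close> for \<open>y = (s - K)\<^sup>-\<^sup>1 x\<close>, so that its norm is at most \<open>2\<beta>\<close>.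
\<close>

lemma resolvent_mat_bound:
  assumes K: "bounded_mat R K" and gr: "growth R K t" and t: "0 \<le> t" "t < s"
    and B: "\<And>x. x \<in> l2 R \<Longrightarrow> l2norm R (B x) \<le> \<beta> * l2norm R x"
      "\<And>x. x \<in> l2 R \<Longrightarrow> B (\<lambda>i. of_real s0 * x i - mat_op R K x i) = x"
    and near: "s0 \<le> s" "(s - s0) * \<beta> \<le> 1 / 2" and \<beta>: "0 \<le> \<beta>"
  shows "mat_bound R (resolvent_mat R K s) (2 * \<beta>)"
proof (rule mat_bound_of_row_sums)
  note summ = resolvent_mat_summable[OF K gr t]
  have pow0: "0 \<le> mat_pow R K n i j" if "i \<in> R" "j \<in> R" for n i j
    using bounded_mat_pow[OF K, of n] that by (auto simp: bounded_mat_def mat_bound_nonneg)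
  show "nonneg_mat R (resolvent_mat R K s)"
    unfolding nonneg_mat_def resolvent_mat_def
    using t pow0 by (auto intro!: suminf_nonneg summ divide_nonneg_nonneg simp del: power_Suc)
  let ?z = "complex_of_real s"
  have s: "t < cmod ?z" using t by simp
  fix F G and x :: "nat \<Rightarrow> real"
  assume *: "finite F" "F \<subseteq> R" "finite G" "G \<subseteq> R" "\<And>i. 0 \<le> x i"
  define X where "X = (\<lambda>i. if i \<in> G then complex_of_real (x i) else 0)"
  have X: "X \<in> l2 R" unfolding X_def by (rule finite_support_in_l2[OF *(3,4)])
  have X_norm: "l2norm R X = L2_set x G"
    unfolding X_def l2norm_finite_support[OF *(3,4)] by (simp add: L2_set_def)
  define y where "y = neumann R K ?z X"
  have y: "y \<in> l2 R" unfolding y_def by (rule neumann_in_l2[OF K gr t(1) s X])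
  have yX: "(\<lambda>i. ?z * y i - mat_op R K y i) = X"
    unfolding y_def by (rule neumann_inverse(2)[OF K gr t(1) s X])
  have "(\<lambda>i. of_real s0 * y i - mat_op R K y i) = (\<lambda>i. X i - of_real (s - s0) * y i)"
    using fun_cong[OF yX] by (auto simp: fun_eq_iff algebra_simps)
  then have y_eq: "y = B (\<lambda>i. X i - of_real (s - s0) * y i)"
    using B(2)[OF y] by simp
  have "l2norm R y \<le> \<beta> * l2norm R (\<lambda>i. X i - of_real (s - s0) * y i)"
    using B(1)[OF l2_diff[OF X l2_scale[OF y]]] y_eq by metis
  also have "\<dots> \<le> \<beta> * (l2norm R X + l2norm R (\<lambda>i. of_real (s - s0) * y i))"
    using \<beta> by (intro mult_left_mono l2norm_diff X l2_scale y)
  also have "\<dots> = \<beta> * l2norm R X + ((s - s0) * \<beta>) * l2norm R y"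
  proof -
    have "l2norm R (\<lambda>i. of_real (s - s0) * y i) = (s - s0) * l2norm R y"
      unfolding l2norm_scale using near by (simp del: of_real_diff)
    then show ?thesis by (simp only:) (simp add: algebra_simps)
  qed
  also have "\<dots> \<le> \<beta> * l2norm R X + 1 / 2 * l2norm R y"
    using near by (intro add_left_mono mult_right_mono) auto
  finally have y_norm: "l2norm R y \<le> 2 * \<beta> * L2_set x G" using X_norm by simp
  have entry: "y i = of_real (\<Sum>j\<in>G. resolvent_mat R K s i j * x j)" if i: "i \<in> R" for i
  proof -
    have "(mat_op R K ^^ n) X i = of_real (\<Sum>j\<in>G. mat_pow R K n i j * x j)" for n
    proof -
      have "(mat_op R K ^^ n) X i = (\<Sum>\<^sub>\<infinity>j\<in>R. of_real (mat_pow R K n i j) * X j)"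
        unfolding mat_op_pow[OF K X, symmetric] using i by (simp add: mat_op_def)
      also have "\<dots> = (\<Sum>\<^sub>\<infinity>j\<in>G. of_real (mat_pow R K n i j) * X j)"
        by (rule infsum_cong_neutral) (use *(4) in \<open>auto simp: X_def\<close>)
      also have "\<dots> = of_real (\<Sum>j\<in>G. mat_pow R K n i j * x j)"
        using *(3) by (simp add: X_def)
      finally show ?thesis .
    qed
    then have "y i = (\<Sum>n. of_real (\<Sum>j\<in>G. mat_pow R K n i j / s ^ Suc n * x j))"
      unfolding y_def neumann_def by (simp add: sum_divide_distrib of_real_divide)
    also have "\<dots> = of_real (\<Sum>n. \<Sum>j\<in>G. mat_pow R K n i j / s ^ Suc n * x j)"
      using *(4) i by (intro suminf_of_real[symmetric] summable_sum summable_mult2 summ) auto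
    also have "(\<Sum>n. \<Sum>j\<in>G. mat_pow R K n i j / s ^ Suc n * x j) =
        (\<Sum>j\<in>G. \<Sum>n. mat_pow R K n i j / s ^ Suc n * x j)"
      using *(4) i by (intro suminf_sum summable_mult2 summ) auto
    also have "\<dots> = (\<Sum>j\<in>G. resolvent_mat R K s i j * x j)"
      unfolding resolvent_mat_def using *(4) i
      by (intro sum.cong refl suminf_mult2[symmetric] summ) auto
    finally show ?thesis .
  qed
  have "L2_set (\<lambda>i. \<Sum>j\<in>G. resolvent_mat R K s i j * x j) F \<le> L2_set (\<lambda>i. cmod (y i)) F"
  proof -
    have "L2_set (\<lambda>i. cmod (y i)) F = L2_set (\<lambda>i. \<Sum>j\<in>G. resolvent_mat R K s i j * x j) F"
      unfolding L2_set_def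
      using subsetD[OF *(2)] by (auto simp: entry norm_of_real simp del: of_real_sum intro!: sum.cong)
    then show ?thesis by simp
  qed
  also have "\<dots> \<le> l2norm R y" by (rule L2_set_le_l2norm[OF y *(1,2)])
  also have "\<dots> \<le> 2 * \<beta> * L2_set x G" by (rule y_norm)
  finally show "L2_set (\<lambda>i. \<Sum>j\<in>G. resolvent_mat R K s i j * x j) F \<le> 2 * \<beta> * L2_set x G" .
qed (use \<beta> in simp)

lemma has_sum_finite_sum:
  fixes f :: "'a \<Rightarrow> 'b \<Rightarrow> 'c :: topological_comm_monoid_add"
  assumes "finite I" "\<And>a. a \<in> I \<Longrightarrow> (f a has_sum s a) A"
  shows "((\<lambda>k. \<Sum>a\<in>I. f a k) has_sum (\<Sum>a\<in>I. s a)) A"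
  using assms by (induction I) (auto intro!: has_sum_add)

text \<open>
  The square of the resolvent is \<open>\<Sum>\<^sub>n (n+1) K\<^sup>n / s\<^sup>n\<^sup>+\<^sup>2\<close>, and a nonnegative series dominates each
  of its terms. The factor \<open>n+1\<close> is what improves on the bound from the resolvent itself.
\<close>

lemma mat_pow_le_resolvent_square:
  assumes K: "bounded_mat R K" and gr: "growth R K t" and t: "0 \<le> t" "t < s"
    and G: "bounded_mat R (resolvent_mat R K s)" and ij: "i \<in> R" "j \<in> R"
  shows "real (n + 1) * mat_pow R K n i j / s ^ (n + 2)
    \<le> mat_times R (resolvent_mat R K s) (resolvent_mat R K s) i j"
proof -
  let ?G = "resolvent_mat R K s" and ?P = "mat_pow R K"
  note summ = resolvent_mat_summable[OF K gr t]
  have s: "s > 0" using t by simp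
  have P: "\<exists>C. mat_bound R (?P n) C" for n
    using bounded_mat_pow[OF K] by (auto simp: bounded_mat_def)
  have pow0: "0 \<le> ?P n i j" if "i \<in> R" "j \<in> R" for n i j
    using P that mat_bound_nonneg by blast
  have term0: "0 \<le> ?P n i j / s ^ Suc n" if "i \<in> R" "j \<in> R" for n i j
    using pow0[OF that] s by (simp del: power_Suc)
  have partial: "(\<Sum>a\<le>n. ?P a i j / s ^ Suc a) \<le> ?G i j" if "i \<in> R" "j \<in> R" for i j
    unfolding resolvent_mat_def
    by (rule sum_le_suminf[OF summ[OF that]]) (use term0[OF that] in auto)
  have single: "?P a i j / s ^ Suc a \<le> ?G i j" if "i \<in> R" "j \<in> R" for a i j
    using sum_le_suminf[OF summ[OF that], of "{a}"] term0[OF that]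
    by (simp add: resolvent_mat_def del: power_Suc)
  have pw: "s ^ Suc a * s ^ Suc (n - a) = s ^ (n + 2)" if "a \<le> n" for a
  proof -
    have "Suc a + Suc (n - a) = n + 2" using that by simp
    then show ?thesis by (metis power_add)
  qed
  have le: "(\<Sum>a\<le>n. ?P a i k * ?P (n - a) k j / s ^ (n + 2)) \<le> ?G i k * ?G k j" if k: "k \<in> R" for k
  proof -
    have "(\<Sum>a\<le>n. ?P a i k * ?P (n - a) k j / s ^ (n + 2)) =
        (\<Sum>a\<le>n. (?P a i k / s ^ Suc a) * (?P (n - a) k j / s ^ Suc (n - a)))"
      by (intro sum.cong refl) (simp add: pw times_divide_times_eq del: power_Suc)
    also have "\<dots> \<le> (\<Sum>a\<le>n. (?P a i k / s ^ Suc a) * ?G k j)"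
      by (intro sum_mono mult_left_mono single term0 ij k)
    also have "\<dots> = (\<Sum>a\<le>n. ?P a i k / s ^ Suc a) * ?G k j"
      by (rule sum_distrib_right[symmetric])
    also have "\<dots> \<le> ?G i k * ?G k j"
      using term0[OF k ij(2), of 0] single[OF k ij(2), of 0]
      by (intro mult_right_mono partial ij k) linarith
    finally show ?thesis .
  qed
  have "((\<lambda>k. ?P a i k * ?P (n - a) k j / s ^ (n + 2)) has_sum (?P n i j / s ^ (n + 2))) R"
    if "a \<le> n" for a
  proof -
    obtain C D where CD: "mat_bound R (?P a) C" "mat_bound R (?P (n - a)) D" using P by blast
    have "((\<lambda>k. ?P a i k * ?P (n - a) k j) has_sum (?P n i j)) R"
      using has_sum_infsum[OF mat_times_summable[OF CD ij]] mat_pow_add[OF K ij, of a "n - a"] that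
      by (simp add: mat_times_def)
    then show ?thesis by (rule has_sum_divide_const)
  qed
  then have hs: "((\<lambda>k. \<Sum>a\<le>n. ?P a i k * ?P (n - a) k j / s ^ (n + 2)) has_sum
      (\<Sum>a\<le>n. ?P n i j / s ^ (n + 2))) R"
    by (intro has_sum_finite_sum) auto
  obtain C where "mat_bound R ?G C" using G by (auto simp: bounded_mat_def)
  then have "(\<lambda>k. ?G i k * ?G k j) summable_on R" using mat_times_summable ij by blast
  from has_sum_mono[OF hs has_sum_infsum[OF this] le]
  show ?thesis by (simp add: mat_times_def)
qed

text \<open>
  Pringsheim's theorem for the resolvent: it cannot be continued to the abscissa of convergence of
  its Neumann series. Indeed, a bounded resolvent near \<open>s\<^sub>0\<close> would give \<open>\<parallel>K\<^sup>n\<parallel> \<le> 4\<beta>\<^sup>2 s\<^sub>0\<^sup>n\<^sup>+\<^sup>2 / (n+1)\<close>.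
  For \<open>s\<^sub>0 = 0\<close> this contradicts \<open>K\<^sup>0 \<noteq> 0\<close>; for \<open>s\<^sub>0 > 0\<close> some power has norm below \<open>s\<^sub>0\<^sup>n / 2\<close>, and then
  the powers grow more slowly than \<open>s\<^sub>0\<^sup>n\<close>.
\<close>

lemma growth_Inf_in_spectrum:
  assumes K: "bounded_mat R K" and R: "R \<noteq> {}"
  defines "s0 \<equiv> Inf {s. 0 < s \<and> growth R K s}"
  shows "complex_of_real s0 \<in> operator_spectrum R (mat_op R K)" and "0 \<le> s0"
    and "\<And>s. s0 < s \<Longrightarrow> growth R K s"
proof -
  let ?E = "{s. 0 < s \<and> growth R K s}"
  obtain C where C: "mat_bound R K C" using K unfolding bounded_mat_def by blast
  then have "mat_bound R K (C + 1)" by (rule mat_bound_mono_const) simp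
  then have "C + 1 \<in> ?E"
    using mat_bound_growth mat_bound_const_nonneg[OF C] by auto
  then have ne: "?E \<noteq> {}" by blast
  have bdd: "bdd_below ?E" by (rule bdd_belowI[of _ 0]) auto
  show s0: "0 \<le> s0" unfolding s0_def by (rule cInf_greatest[OF ne]) auto
  have above: "\<exists>t\<in>?E. t < s" if "s0 < s" for s
    using cInf_lessD[OF ne] that unfolding s0_def by blast
  show "growth R K s" if "s0 < s" for s
    using above[OF that] growth_mono_rate by fastforce
  show "complex_of_real s0 \<in> operator_spectrum R (mat_op R K)"
  proof (rule ccontr)
    assume "complex_of_real s0 \<notin> operator_spectrum R (mat_op R K)"
    then obtain B where B: "bounded_operator R B"
        "\<And>x. x \<in> l2 R \<Longrightarrow> B (\<lambda>i. of_real s0 * x i - mat_op R K x i) = x"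
      unfolding operator_spectrum_def by blast
    obtain b where b: "\<And>x. x \<in> l2 R \<Longrightarrow> l2norm R (B x) \<le> b * l2norm R x"
      using B(1) unfolding bounded_operator_def by blast
    define \<beta> where "\<beta> = max b 1"
    have \<beta>: "\<beta> > 0" by (simp add: \<beta>_def)
    have B\<beta>: "l2norm R (B x) \<le> \<beta> * l2norm R x" if "x \<in> l2 R" for x
    proof -
      have "b * l2norm R x \<le> \<beta> * l2norm R x" by (intro mult_right_mono) (auto simp: \<beta>_def)
      with b[OF that] show ?thesis by linarith
    qed
    have near: "mat_bound R (mat_pow R K n) (2 * \<beta> * (2 * \<beta>) * s ^ (n + 2) / (n + 1))"
      if s: "s \<in> {s0<..<s0 + 1 / (2 * \<beta>)}" for s n
    proof -
      obtain t where t: "growth R K t" "0 \<le> t" "t < s" using above[of s] s by force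
      have "(s - s0) * \<beta> \<le> 1 / 2" using s \<beta> by (simp add: field_simps)
      then have G: "mat_bound R (resolvent_mat R K s) (2 * \<beta>)"
        using s \<beta> by (intro resolvent_mat_bound[OF K t B\<beta> B(2)]) auto
      have s_pos: "s > 0" using s s0 by simp
      have "mat_bound R (\<lambda>i j. real (n + 1) * mat_pow R K n i j / s ^ (n + 2)) (2 * \<beta> * (2 * \<beta>))"
      proof (rule mat_bound_mono[OF mat_bound_times[OF G G]], rule conjI)
        fix i j assume ij: "i \<in> R" "j \<in> R"
        show "0 \<le> real (n + 1) * mat_pow R K n i j / s ^ (n + 2)"
          using bounded_mat_pow[OF K, of n] ij s_pos by (auto simp: bounded_mat_def mat_bound_nonneg)
        show "real (n + 1) * mat_pow R K n i j / s ^ (n + 2)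
            \<le> mat_times R (resolvent_mat R K s) (resolvent_mat R K s) i j"
          using G by (intro mat_pow_le_resolvent_square[OF K t _ ij]) (auto simp: bounded_mat_def)
      qed
      from mat_bound_scale[OF this, of "s ^ (n + 2) / (n + 1)"]
      have "mat_bound R (\<lambda>i j. s ^ (n + 2) / (n + 1) * (real (n + 1) * mat_pow R K n i j / s ^ (n + 2)))
          (s ^ (n + 2) / (n + 1) * (2 * \<beta> * (2 * \<beta>)))"
        using s_pos by simp
      moreover have "s ^ (n + 2) / (n + 1) * (real (n + 1) * mat_pow R K n i j / s ^ (n + 2)) =
          mat_pow R K n i j" for i j
        using s_pos by (simp del: power_Suc add_2_eq_Suc' of_nat_add)
      moreover have "s ^ (n + 2) / (n + 1) * (2 * \<beta> * (2 * \<beta>)) =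
          2 * \<beta> * (2 * \<beta>) * s ^ (n + 2) / (n + 1)" by simp
      ultimately show ?thesis by (simp only:)
    qed
    have at0: "mat_bound R (mat_pow R K n) (2 * \<beta> * (2 * \<beta>) * s0 ^ (n + 2) / (n + 1))" for n
    proof (rule mat_bound_tendsto)
      show "((\<lambda>s. 2 * \<beta> * (2 * \<beta>) * s ^ (n + 2) / (n + 1)) \<longlongrightarrow>
          2 * \<beta> * (2 * \<beta>) * s0 ^ (n + 2) / (n + 1)) (at_right s0)"
        by (intro tendsto_intros) auto
      show "\<forall>\<^sub>F s in at_right s0. mat_bound R (mat_pow R K n) (2 * \<beta> * (2 * \<beta>) * s ^ (n + 2) / (n + 1))"
        by (rule eventually_mono[OF eventually_at_right_real[of s0 "s0 + 1 / (2 * \<beta>)"]])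
          (use near \<beta> in auto)
    qed simp
    obtain i where i: "i \<in> R" using R by blast
    \<comment> \<open>At \<open>s\<^sub>0 = 0\<close> the bound for \<open>n = 0\<close> would make the identity matrix zero.\<close>
    have s0_pos: "s0 > 0"
    proof (rule ccontr)
      assume "\<not> s0 > 0"
      then have "s0 = 0" using s0 by simp
      then show False using mat_bound_entry[OF at0[of 0] i i] by (simp add: mat_one_def)
    qed
    \<comment> \<open>This \<open>n\<close> makes \<open>4\<beta>\<^sup>2 s\<^sub>0\<^sup>2 / (n+1)\<close> less than \<open>1/2\<close>.\<close>
    obtain n where n: "8 * \<beta> * \<beta> * s0\<^sup>2 < real n" using reals_Archimedean2 by blast
    then have n_pos: "n > 0" using \<beta> s0_pos
      by (metis gr0I less_irrefl mult_nonneg_nonneg not_less of_nat_0 order_less_imp_le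
          zero_le_numeral zero_le_power2)
    have "2 * \<beta> * (2 * \<beta>) * s0 ^ (n + 2) / (n + 1) \<le> s0 ^ n / 2"
    proof -
      have "2 * \<beta> * (2 * \<beta>) * s0 ^ (n + 2) / (n + 1) = (4 * \<beta> * \<beta> * s0\<^sup>2) / (n + 1) * s0 ^ n"
        by (simp add: power2_eq_square)
      also have "\<dots> \<le> 1 / 2 * s0 ^ n"
        using n s0_pos by (intro mult_right_mono) (auto simp: field_simps)
      finally show ?thesis by simp
    qed
    from mat_bound_mono_const[OF at0 this]
    have half: "mat_bound R (mat_pow R K n) (s0 ^ n / 2)" .
    define t where "t = s0 * root n (1 / 2)"
    have r: "root n (1/2) < 1" "root n (1/2) > 0" "root n (1/2) ^ n = 1/2"
      using n_pos by (auto simp: real_root_lt_1_iff)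
    have tn: "t ^ n = s0 ^ n / 2" using r by (simp add: t_def power_mult_distrib)
    have "growth R (mat_pow R K n) (t ^ n)" unfolding tn by (rule mat_bound_growth[OF half])
    moreover have t: "t > 0" "t < s0" using s0_pos r by (auto simp: t_def)
    ultimately have "t \<in> ?E" using growth_root[OF K n_pos] by simp
    then have "s0 \<le> t" unfolding s0_def by (rule cInf_lower[OF _ bdd])
    with t show False by simp
  qed
qed

text \<open>
  Inequalities between spectral radii thus become comparisons of growth: if every growth rate
  \<open>s\<close> of \<open>L\<close> gives the rate \<open>f s\<close> for \<open>K\<close>, with \<open>f\<close> continuous, then \<open>r(K) \<le> f (r(L))\<close>.
\<close>

lemma
  assumes K: "bounded_mat R K" and R: "R \<noteq> {}"
  shows spectral_radius_nonneg: "0 \<le> mat_spectral_radius R K"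
    and spectral_radius_le: "growth R K s \<Longrightarrow> 0 \<le> s \<Longrightarrow> mat_spectral_radius R K \<le> s"
    and growth_above_spectral_radius: "mat_spectral_radius R K < s \<Longrightarrow> growth R K s"
proof -
  let ?\<sigma> = "operator_spectrum R (mat_op R K)"
  define s0 where "s0 = Inf {s. 0 < s \<and> growth R K s}"
  note s0 = growth_Inf_in_spectrum[OF K R, folded s0_def]
  have le: "mat_spectral_radius R K \<le> s" if "growth R K s" "0 \<le> s" for s
    unfolding mat_spectral_radius_def operator_spectral_radius_def
    by (rule cSup_least) (use s0 spectrum_norm_le[OF K that] in auto)
  then show "growth R K s \<Longrightarrow> 0 \<le> s \<Longrightarrow> mat_spectral_radius R K \<le> s" .
  have "bdd_above (cmod ` ?\<sigma>)"
    using spectrum_norm_le[OF K s0(3)[of "s0 + 1"]] s0(2) by (auto intro!: bdd_aboveI2[where M = "s0 + 1"])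
  then have "cmod (complex_of_real s0) \<le> mat_spectral_radius R K"
    unfolding mat_spectral_radius_def operator_spectral_radius_def
    using s0(1) by (intro cSup_upper imageI)
  then have *: "s0 \<le> mat_spectral_radius R K" using s0(2) by simp
  then show "0 \<le> mat_spectral_radius R K" using s0(2) by simp
  show "growth R K s" if "mat_spectral_radius R K < s" using s0(3) * that by simp
qed

section \<open>Hadamard products of entrywise powers\<close>

text \<open>
  For numbers in \<open>[0, 1]\<close>, an exponent \<open>\<alpha> \<ge> 1/n\<close> may be lowered to \<open>1/n\<close>, where this is the
  inequality between the arithmetic and the geometric mean. The condition \<open>n \<alpha> \<ge> 1\<close> in the
  estimates below has its origin here.
\<close>

lemma prod_powr_le_mean:
  fixes a :: "nat \<Rightarrow> real" and \<alpha> :: real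
  assumes n: "n > 0" and \<alpha>: "1 \<le> \<alpha> * n" and a: "\<And>l. l \<in> {1..n} \<Longrightarrow> 0 \<le> a l \<and> a l \<le> 1"
  shows "(\<Prod>l=1..n. a l powr \<alpha>) \<le> (\<Sum>l=1..n. a l) / n"
proof -
  have "(\<Prod>l=1..n. a l powr \<alpha>) = (\<Prod>l=1..n. a l) powr \<alpha>"
    by (rule prod_powr_distrib[symmetric])
  also have "\<dots> \<le> (\<Prod>l=1..n. a l) powr (1 / n)"
    using n \<alpha> a by (intro powr_mono' prod_nonneg prod_le_1) (auto simp: field_simps)
  also have "\<dots> \<le> (\<Sum>l=1..n. a l / n)"
    using arith_geom_mean[of "{1..n}" a] n a by simp
  finally show ?thesis by (simp add: sum_divide_distrib)
qed

text \<open>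
  By homogeneity the numbers may be bounded by any positive \<open>s\<^sub>l\<close>. The right-hand side is linear in
  the \<open>a\<^sub>l\<close>, and so it can be summed over indices or estimated in norm.
\<close>

lemma prod_powr_scaled_le:
  fixes a s :: "nat \<Rightarrow> real" and \<alpha> :: real
  assumes n: "n > 0" and \<alpha>: "1 \<le> \<alpha> * n"
    and a: "\<And>l. l \<in> {1..n} \<Longrightarrow> 0 \<le> a l \<and> a l \<le> s l" and s: "\<And>l. l \<in> {1..n} \<Longrightarrow> 0 < s l"
  shows "(\<Prod>l=1..n. a l powr \<alpha>) \<le> (\<Prod>l=1..n. s l powr \<alpha>) / n * (\<Sum>l=1..n. 1 / s l * a l)"
proof -
  have "(\<Prod>l=1..n. a l powr \<alpha>) = (\<Prod>l=1..n. s l powr \<alpha> * (a l / s l) powr \<alpha>)"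
  proof (rule prod.cong[OF refl])
    fix l assume l: "l \<in> {1..n}"
    have "a l powr \<alpha> = (s l * (a l / s l)) powr \<alpha>" using s[OF l] by simp
    also have "\<dots> = s l powr \<alpha> * (a l / s l) powr \<alpha>"
      by (rule powr_mult)
    finally show "a l powr \<alpha> = s l powr \<alpha> * (a l / s l) powr \<alpha>" .
  qed
  also have "\<dots> = (\<Prod>l=1..n. s l powr \<alpha>) * (\<Prod>l=1..n. (a l / s l) powr \<alpha>)"
    by (rule prod.distrib)
  also have "\<dots> \<le> (\<Prod>l=1..n. s l powr \<alpha>) * ((\<Sum>l=1..n. a l / s l) / n)"
    using a s by (intro mult_left_mono prod_powr_le_mean n \<alpha> prod_nonneg) (auto simp: less_imp_le)
  finally show ?thesis by simp
qed

text \<open>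
  Hoelder's inequality, with sums of exponents above \<open>1\<close> admitted because the terms of a
  nonnegative sum are at most the sum itself. That bound is the \<open>s\<^sub>l\<close> of the scaled inequality.
\<close>

lemma Holder_infsum:
  fixes f :: "nat \<Rightarrow> 'a \<Rightarrow> real" and \<alpha> :: real
  assumes n: "n > 0" and \<alpha>: "1 \<le> \<alpha> * n"
    and f: "\<And>l k. l \<in> {1..n} \<Longrightarrow> k \<in> R \<Longrightarrow> 0 \<le> f l k" "\<And>l. l \<in> {1..n} \<Longrightarrow> f l summable_on R"
  shows "(\<Sum>\<^sub>\<infinity>k\<in>R. \<Prod>l=1..n. f l k powr \<alpha>) \<le> (\<Prod>l=1..n. (\<Sum>\<^sub>\<infinity>k\<in>R. f l k) powr \<alpha>)"
proof -
  define s where "s l = (\<Sum>\<^sub>\<infinity>k\<in>R. f l k)" for l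
  have s0: "0 \<le> s l" if "l \<in> {1..n}" for l
    unfolding s_def by (rule infsum_nonneg) (use f(1)[OF that] in auto)
  show ?thesis
  proof (cases "\<exists>l\<in>{1..n}. s l = 0")
    case True
    then obtain l where l: "l \<in> {1..n}" "s l = 0" by blast
    have "f l k = 0" if "k \<in> R" for k
      by (rule nonneg_infsum_le_0D[of "f l" R]) (use l f that in \<open>auto simp: s_def\<close>)
    then have "(\<Prod>l=1..n. f l k powr \<alpha>) = 0" if "k \<in> R" for k
      using l(1) that by (intro prod_zero bexI[of _ l]) auto
    then have "(\<Sum>\<^sub>\<infinity>k\<in>R. \<Prod>l=1..n. f l k powr \<alpha>) = 0" by (intro infsum_0)
    then show ?thesis by (simp add: prod_nonneg)
  next
    case False
    then have s: "0 < s l" if "l \<in> {1..n}" for l using s0[OF that] that by fastforce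
    have le: "f l k \<le> s l" if "l \<in> {1..n}" "k \<in> R" for l k
      using finite_sum_le_infsum[OF f(2)[OF that(1)], of "{k}"] f(1)[OF that(1)] that
      by (simp add: s_def)
    define P where "P = (\<Prod>l=1..n. s l powr \<alpha>)"
    have bd: "(\<Prod>l=1..n. f l k powr \<alpha>) \<le> P / n * (\<Sum>l=1..n. 1 / s l * f l k)" if "k \<in> R" for k
      unfolding P_def using f le s that by (intro prod_powr_scaled_le n \<alpha>) auto
    have "((\<lambda>k. P / n * (\<Sum>l=1..n. 1 / s l * f l k)) has_sum (P / n * (\<Sum>l=1..n. 1 / s l * s l))) R"
      unfolding s_def using f(2)
      by (intro has_sum_cmult_right has_sum_finite_sum has_sum_infsum) auto
    moreover have "P / n * (\<Sum>l=1..n. 1 / s l * s l) = P"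
    proof -
      have "(\<Sum>l=1..n. 1 / s l * s l) = (\<Sum>l=1..n. 1)" using s by (intro sum.cong) fastforce+
      then show ?thesis using n by simp
    qed
    ultimately have hs: "((\<lambda>k. P / n * (\<Sum>l=1..n. 1 / s l * f l k)) has_sum P) R" by simp
    have "(\<lambda>k. \<Prod>l=1..n. f l k powr \<alpha>) summable_on R"
      by (rule summable_on_comparison_test[OF has_sum_imp_summable[OF hs] bd]) (auto intro: prod_nonneg)
    from has_sum_mono[OF has_sum_infsum[OF this] hs bd]
    show ?thesis by (simp add: P_def s_def)
  qed
qed

lemma hadamard_pow_prod_apply: "hadamard_pow_prod \<alpha> K n i j = (\<Prod>l=1..n. K l i j powr \<alpha>)"
  by (simp add: hadamard_pow_prod_def hadamard_pow_def)

lemma hadamard_pow_prod_nonneg: "0 \<le> hadamard_pow_prod \<alpha> K n i j"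
  by (simp add: hadamard_pow_prod_apply prod_nonneg)

lemma mat_bound_add:
  assumes "mat_bound R K C" "mat_bound R L D"
  shows "mat_bound R (\<lambda>i j. K i j + L i j) (C + D)"
proof (rule mat_boundI)
  fix F G and x y :: "nat \<Rightarrow> real"
  assume *: "finite F" "F \<subseteq> R" "finite G" "G \<subseteq> R" "\<And>i. 0 \<le> x i" "\<And>i. 0 \<le> y i"
  have "(\<Sum>i\<in>F. \<Sum>j\<in>G. (K i j + L i j) * y i * x j) =
      (\<Sum>i\<in>F. \<Sum>j\<in>G. K i j * y i * x j) + (\<Sum>i\<in>F. \<Sum>j\<in>G. L i j * y i * x j)"
    by (simp add: ring_distribs sum.distrib)
  also have "\<dots> \<le> C * L2_set y F * L2_set x G + D * L2_set y F * L2_set x G"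
    by (intro add_mono mat_boundD[OF assms(1) *] mat_boundD[OF assms(2) *])
  finally show "(\<Sum>i\<in>F. \<Sum>j\<in>G. (K i j + L i j) * y i * x j) \<le> (C + D) * L2_set y F * L2_set x G"
    by (simp add: ring_distribs)
qed (use assms in \<open>auto simp: mat_bound_def nonneg_mat_def\<close>)

lemma mat_bound_zero: "mat_bound R (\<lambda>i j. 0) 0"
  by (simp add: mat_bound_def nonneg_mat_def)

lemma mat_bound_sum:
  assumes "finite I" "\<And>l. l \<in> I \<Longrightarrow> mat_bound R (K l) (c l)"
  shows "mat_bound R (\<lambda>i j. \<Sum>l\<in>I. K l i j) (\<Sum>l\<in>I. c l)"
  using assms
proof (induction I rule: finite_induct)
  case (insert l I)
  then show ?case using mat_bound_add[of R "K l" "c l" "\<lambda>i j. \<Sum>l\<in>I. K l i j"] by simp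
qed (simp add: mat_bound_zero)

text \<open>
  The entries of \<open>K\<^sub>l\<close> are at most \<open>c\<^sub>l\<close>, and so the Hadamard product is dominated entrywise by a
  weighted sum of the \<open>K\<^sub>l\<close>, for which the triangle inequality gives exactly \<open>\<Prod>\<^sub>l c\<^sub>l\<^sup>\<alpha>\<close>.
\<close>

lemma mat_bound_hadamard:
  assumes n: "n > 0" and \<alpha>: "1 \<le> \<alpha> * real n"
    and K: "\<And>l. l \<in> {1..n} \<Longrightarrow> mat_bound R (K l) (c l)" and c: "\<And>l. l \<in> {1..n} \<Longrightarrow> 0 < c l"
  shows "mat_bound R (hadamard_pow_prod \<alpha> K n) (\<Prod>l=1..n. c l powr \<alpha>)"
proof -
  define P where "P = (\<Prod>l=1..n. c l powr \<alpha>)"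
  have P0: "0 \<le> P" unfolding P_def by (intro prod_nonneg) auto
  have "mat_bound R (\<lambda>i j. P / n * (\<Sum>l=1..n. 1 / c l * K l i j)) (P / n * (\<Sum>l=1..n. 1 / c l * c l))"
    using K c P0 by (intro mat_bound_scale mat_bound_sum) (auto simp: less_imp_le)
  moreover have "P / n * (\<Sum>l=1..n. 1 / c l * c l) = P"
  proof -
    have "(\<Sum>l=1..n. 1 / c l * c l) = (\<Sum>l=1..n. 1)" using c by (intro sum.cong) fastforce+
    then show ?thesis using n by simp
  qed
  ultimately have "mat_bound R (\<lambda>i j. P / n * (\<Sum>l=1..n. 1 / c l * K l i j)) P" by simp
  then show ?thesis unfolding P_def[symmetric]
  proof (rule mat_bound_mono)
    fix i j assume ij: "i \<in> R" "j \<in> R"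
    have "hadamard_pow_prod \<alpha> K n i j \<le> P / n * (\<Sum>l=1..n. 1 / c l * K l i j)"
      unfolding hadamard_pow_prod_apply P_def
      using mat_bound_nonneg[OF K ij] mat_bound_entry[OF K ij] c by (intro prod_powr_scaled_le n \<alpha>) auto
    then show "0 \<le> hadamard_pow_prod \<alpha> K n i j \<and>
        hadamard_pow_prod \<alpha> K n i j \<le> P / n * (\<Sum>l=1..n. 1 / c l * K l i j)"
      using hadamard_pow_prod_nonneg by blast
  qed
qed

lemma bounded_mat_pos_bound:
  assumes "bounded_mat R K"
  obtains C where "0 < C" "mat_bound R K C"
proof -
  obtain C where C: "mat_bound R K C" using assms unfolding bounded_mat_def by blast
  show thesis
    by (rule that[of "max C 1"]) (auto intro: mat_bound_mono_const[OF C])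
qed

lemma bounded_mat_hadamard:
  assumes "n > 0" "1 \<le> \<alpha> * real n" "\<And>l. l \<in> {1..n} \<Longrightarrow> bounded_mat R (K l)"
  shows "bounded_mat R (hadamard_pow_prod \<alpha> K n)"
proof -
  have "\<exists>C>0. mat_bound R (K l) C" if "l \<in> {1..n}" for l
    using bounded_mat_pos_bound[OF assms(3)[OF that]] by blast
  then obtain c where "\<And>l. l \<in> {1..n} \<Longrightarrow> c l > 0 \<and> mat_bound R (K l) (c l)" by metis
  then show ?thesis
    using mat_bound_hadamard[OF assms(1,2), of R K c] unfolding bounded_mat_def by blast
qed

text \<open>
  Each entry of the product is a sum over the middle index, to which Hoelder's inequality applies.
\<close>

lemma mat_times_hadamard_le:
  assumes n: "n > 0" and \<alpha>: "1 \<le> \<alpha> * real n"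
    and K: "\<And>l. l \<in> {1..n} \<Longrightarrow> bounded_mat R (K l)" and L: "\<And>l. l \<in> {1..n} \<Longrightarrow> bounded_mat R (L l)"
    and ij: "i \<in> R" "j \<in> R"
  shows "mat_times R (hadamard_pow_prod \<alpha> K n) (hadamard_pow_prod \<alpha> L n) i j
    \<le> hadamard_pow_prod \<alpha> (\<lambda>l. mat_times R (K l) (L l)) n i j"
proof -
  have nn: "0 \<le> K l i k" "0 \<le> L l k j" if "l \<in> {1..n}" "k \<in> R" for l k
    using K[OF that(1)] L[OF that(1)] ij that(2) by (auto simp: bounded_mat_def mat_bound_nonneg)
  have "mat_times R (hadamard_pow_prod \<alpha> K n) (hadamard_pow_prod \<alpha> L n) i j =
      (\<Sum>\<^sub>\<infinity>k\<in>R. \<Prod>l=1..n. (K l i k * L l k j) powr \<alpha>)"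
    unfolding mat_times_def hadamard_pow_prod_apply prod.distrib[symmetric]
    by (simp add: powr_mult)
  also have "\<dots> \<le> (\<Prod>l=1..n. (\<Sum>\<^sub>\<infinity>k\<in>R. K l i k * L l k j) powr \<alpha>)"
  proof (rule Holder_infsum[OF n \<alpha>])
    fix l assume l: "l \<in> {1..n}"
    show "(\<lambda>k. K l i k * L l k j) summable_on R"
      using K[OF l] L[OF l] mat_times_summable ij unfolding bounded_mat_def by blast
  qed (use nn in auto)
  finally show ?thesis by (simp add: hadamard_pow_prod_apply mat_times_def)
qed

lemma mat_prod_list_hadamard_le:
  assumes n: "n > 0" and \<alpha>: "1 \<le> \<alpha> * real n"
    and K: "\<And>l k. l \<in> {1..n} \<Longrightarrow> k \<in> set ks \<Longrightarrow> bounded_mat R (K l k)"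
    and ij: "i \<in> R" "j \<in> R"
  shows "0 \<le> mat_prod_list R (map (\<lambda>k. hadamard_pow_prod \<alpha> (\<lambda>l. K l k) n) ks) i j \<and>
    mat_prod_list R (map (\<lambda>k. hadamard_pow_prod \<alpha> (\<lambda>l. K l k) n) ks) i j
      \<le> hadamard_pow_prod \<alpha> (\<lambda>l. mat_prod_list R (map (K l) ks)) n i j"
  using K ij
proof (induction ks arbitrary: i)
  case Nil
  show ?case by (auto simp: hadamard_pow_prod_apply mat_one_def intro: prod_nonneg)
next
  case (Cons k ks)
  let ?h = "\<lambda>k. hadamard_pow_prod \<alpha> (\<lambda>l. K l k) n"
  let ?Q = "\<lambda>l. mat_prod_list R (map (K l) ks)"
  have IH: "0 \<le> mat_prod_list R (map ?h ks) i j \<and>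
      mat_prod_list R (map ?h ks) i j \<le> hadamard_pow_prod \<alpha> ?Q n i j" if "i \<in> R" for i
    by (rule Cons.IH) (use Cons.prems that in auto)
  have Q: "bounded_mat R (?Q l)" if "l \<in> {1..n}" for l
    by (rule bounded_mat_prod_list) (use Cons.prems(1)[OF that] in auto)
  have hk: "bounded_mat R (?h k)"
    by (rule bounded_mat_hadamard[OF n \<alpha>]) (use Cons.prems(1) in auto)
  have hQ: "bounded_mat R (hadamard_pow_prod \<alpha> ?Q n)"
    by (rule bounded_mat_hadamard[OF n \<alpha> Q])
  obtain C D where CD: "mat_bound R (?h k) C" "mat_bound R (hadamard_pow_prod \<alpha> ?Q n) D"
    using hk hQ by (auto simp: bounded_mat_def)
  have "mat_times R (?h k) (mat_prod_list R (map ?h ks)) i j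
      \<le> mat_times R (?h k) (hadamard_pow_prod \<alpha> ?Q n) i j"
    using IH Cons.prems by (intro mat_times_mono[OF CD]) (auto simp: hadamard_pow_prod_nonneg)
  also have "\<dots> \<le> hadamard_pow_prod \<alpha> (\<lambda>l. mat_times R (K l k) (?Q l)) n i j"
    by (rule mat_times_hadamard_le[OF n \<alpha> _ Q]) (use Cons.prems in auto)
  finally have "mat_times R (?h k) (mat_prod_list R (map ?h ks)) i j
      \<le> hadamard_pow_prod \<alpha> (\<lambda>l. mat_times R (K l k) (?Q l)) n i j" .
  moreover have "0 \<le> mat_times R (?h k) (mat_prod_list R (map ?h ks)) i j"
    unfolding mat_times_def using IH
    by (intro infsum_nonneg mult_nonneg_nonneg) (auto simp: hadamard_pow_prod_nonneg)
  ultimately show ?case by simp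
qed

text \<open>
  Hence \<open>r(K\<^sub>1\<^sup>(\<^sup>\<alpha>\<^sup>) \<circ> \<dots> \<circ> K\<^sub>n\<^sup>(\<^sup>\<alpha>\<^sup>)) \<le> (r(K\<^sub>1) \<dots> r(K\<^sub>n))\<^sup>\<alpha>\<close>, in terms of growth rates.
\<close>

lemma growth_hadamard:
  assumes n: "n > 0" and \<alpha>: "1 \<le> \<alpha> * real n"
    and K: "\<And>l. l \<in> {1..n} \<Longrightarrow> bounded_mat R (K l)"
    and gr: "\<And>l. l \<in> {1..n} \<Longrightarrow> growth R (K l) (s l)" and s: "\<And>l. l \<in> {1..n} \<Longrightarrow> 0 < s l"
  shows "growth R (hadamard_pow_prod \<alpha> K n) (\<Prod>l=1..n. s l powr \<alpha>)"
proof -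
  have "\<exists>C>0. \<forall>N. mat_bound R (mat_pow R (K l) N) (C * s l ^ N)" if l: "l \<in> {1..n}" for l
  proof -
    obtain C where C: "\<forall>N. mat_bound R (mat_pow R (K l) N) (C * s l ^ N)"
      using gr[OF l] unfolding growth_def by blast
    have "mat_bound R (mat_pow R (K l) N) (max C 1 * s l ^ N)" for N
      by (rule mat_bound_mono_const[OF C[rule_format]]) (use s[OF l] in \<open>auto intro: mult_right_mono\<close>)
    then show ?thesis by (intro exI[of _ "max C 1"]) auto
  qed
  then obtain C where C: "\<And>l. l \<in> {1..n} \<Longrightarrow> 0 < C l"
      "\<And>l N. l \<in> {1..n} \<Longrightarrow> mat_bound R (mat_pow R (K l) N) (C l * s l ^ N)" by metis
  have "mat_bound R (mat_pow R (hadamard_pow_prod \<alpha> K n) N)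
      ((\<Prod>l=1..n. C l powr \<alpha>) * (\<Prod>l=1..n. s l powr \<alpha>) ^ N)" for N
  proof -
    have "mat_bound R (hadamard_pow_prod \<alpha> (\<lambda>l. mat_pow R (K l) N) n)
        (\<Prod>l=1..n. (C l * s l ^ N) powr \<alpha>)"
      using C s by (intro mat_bound_hadamard[OF n \<alpha>]) auto
    then have "mat_bound R (mat_pow R (hadamard_pow_prod \<alpha> K n) N) (\<Prod>l=1..n. (C l * s l ^ N) powr \<alpha>)"
    proof (rule mat_bound_mono)
      fix i j assume "i \<in> R" "j \<in> R"
      from mat_prod_list_hadamard_le[OF n \<alpha> _ this, of "[0..<N]" "\<lambda>l k. K l"] K
      show "0 \<le> mat_pow R (hadamard_pow_prod \<alpha> K n) N i j \<and> mat_pow R (hadamard_pow_prod \<alpha> K n) N i j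
          \<le> hadamard_pow_prod \<alpha> (\<lambda>l. mat_pow R (K l) N) n i j"
        by (simp add: mat_pow_def map_replicate_const)
    qed
    moreover have "(\<Prod>l=1..n. (C l * s l ^ N) powr \<alpha>) =
        (\<Prod>l=1..n. C l powr \<alpha>) * (\<Prod>l=1..n. s l powr \<alpha>) ^ N"
      unfolding prod_power_distrib prod.distrib[symmetric]
    proof (rule prod.cong[OF refl])
      fix l assume l: "l \<in> {1..n}"
      have "(s l ^ N) powr \<alpha> = (s l powr \<alpha>) ^ N"
        using s[OF l] by (simp add: powr_power powr_realpow[symmetric] powr_powr mult.commute)
      then show "(C l * s l ^ N) powr \<alpha> = C l powr \<alpha> * (s l powr \<alpha>) ^ N"
        using C(1)[OF l] s[OF l] by (simp add: powr_mult)
    qed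
    ultimately show ?thesis by simp
  qed
  then show ?thesis unfolding growth_def by blast
qed

text \<open>
  The case \<open>n = 2\<close>, \<open>\<alpha> = 1\<close> of the previous lemma.
\<close>

lemma growth_schur:
  assumes X: "bounded_mat R X" "growth R X s" "0 < s" and Y: "bounded_mat R Y" "growth R Y t" "0 < t"
  shows "growth R (\<lambda>i j. X i j * Y i j) (s * t)"
proof -
  let ?K = "\<lambda>l::nat. if l = 1 then X else Y"
  have bd: "bounded_mat R (hadamard_pow_prod 1 ?K 2)"
    by (rule bounded_mat_hadamard) (use X Y in auto)
  have "growth R (hadamard_pow_prod 1 ?K 2) (\<Prod>l=(1::nat)..2. (if l = 1 then s else t) powr 1)"
    by (rule growth_hadamard) (use X Y in auto)
  moreover have "(\<Prod>l=(1::nat)..2. (if l = 1 then s else t) powr 1) = s * t"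
    using X Y by (simp add: numeral_2_eq_2)
  ultimately have "growth R (hadamard_pow_prod 1 ?K 2) (s * t)" by simp
  then show ?thesis
  proof (rule growth_mono[OF bd, rotated])
    fix i j assume ij: "i \<in> R" "j \<in> R"
    have "0 \<le> X i j" "0 \<le> Y i j"
      using X(1) Y(1) ij by (auto simp: bounded_mat_def mat_bound_nonneg)
    then show "0 \<le> X i j * Y i j \<and> X i j * Y i j \<le> hadamard_pow_prod 1 ?K 2 i j"
      by (simp add: hadamard_pow_prod_apply numeral_2_eq_2)
  qed
qed

section \<open>The norm of a matrix and the spectral radius\<close>

text \<open>
  One half of \<open>\<parallel>M\<parallel>\<^sup>2 = \<parallel>M\<^sup>* M\<parallel>\<close>: expanding \<open>\<parallel>M x\<parallel>\<^sup>2\<close> gives the quadratic form of \<open>M\<^sup>* M\<close>. With only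
  finitely many rows of \<open>M\<close> it can only become smaller, as everything is nonnegative.
\<close>

lemma mat_bound_sqrt:
  assumes M: "bounded_mat R M" and c: "mat_bound R (mat_times R (mat_adj M) M) c"
  shows "mat_bound R M (sqrt c)"
proof (rule mat_bound_of_row_sums)
  show "nonneg_mat R M" using M by (simp add: bounded_mat_iff)
  have c0: "0 \<le> c" by (rule mat_bound_const_nonneg[OF c])
  then show "0 \<le> sqrt c" by simp
  obtain C where C: "mat_bound R M C" using M by (auto simp: bounded_mat_def)
  fix F G and x :: "nat \<Rightarrow> real"
  assume *: "finite F" "F \<subseteq> R" "finite G" "G \<subseteq> R" "\<And>i. 0 \<le> x i"
  have "(\<Sum>i\<in>F. (\<Sum>j\<in>G. M i j * x j)\<^sup>2) = (\<Sum>i\<in>F. \<Sum>j\<in>G. \<Sum>k\<in>G. (M i j * x j) * (M i k * x k))"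
    by (simp add: power2_eq_square sum_product)
  also have "\<dots> = (\<Sum>j\<in>G. \<Sum>i\<in>F. \<Sum>k\<in>G. (M i j * x j) * (M i k * x k))"
    by (rule sum.swap)
  also have "\<dots> = (\<Sum>j\<in>G. \<Sum>k\<in>G. \<Sum>i\<in>F. (M i j * x j) * (M i k * x k))"
    by (intro sum.cong refl sum.swap)
  also have "\<dots> = (\<Sum>j\<in>G. \<Sum>k\<in>G. (\<Sum>i\<in>F. mat_adj M j i * M i k) * x j * x k)"
    by (simp add: sum_distrib_left sum_distrib_right mat_adj_def mult_ac)
  also have "\<dots> \<le> (\<Sum>j\<in>G. \<Sum>k\<in>G. mat_times R (mat_adj M) M j k * x j * x k)"
  proof (intro sum_mono mult_right_mono)
    fix j k assume jk: "j \<in> G" "k \<in> G"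
    show "(\<Sum>i\<in>F. mat_adj M j i * M i k) \<le> mat_times R (mat_adj M) M j k"
      unfolding mat_times_def using jk *
      by (intro finite_sum_le_infsum mat_times_summable[OF mat_bound_adj[OF C] C])
        (auto simp: mat_adj_def subset_iff intro!: mult_nonneg_nonneg mat_bound_nonneg[OF C])
  qed (use * in auto)
  also have "\<dots> \<le> c * L2_set x G * L2_set x G"
    by (rule mat_boundD[OF c]) (use * in auto)
  finally have "L2_set (\<lambda>i. \<Sum>j\<in>G. M i j * x j) F \<le> sqrt (c * L2_set x G * L2_set x G)"
    by (simp add: L2_set_def[of _ F])
  also have "\<dots> = sqrt c * L2_set x G" by (simp add: real_sqrt_mult)
  finally show "L2_set (\<lambda>i. \<Sum>j\<in>G. M i j * x j) F \<le> sqrt c * L2_set x G" .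
qed

text \<open>
  The norm of a symmetric matrix is at most its spectral radius. Since \<open>P\<^sup>2\<^sup>n = (P\<^sup>n)\<^sup>* P\<^sup>n\<close>, the
  previous lemma takes the square root of the constant in \<open>\<parallel>P\<^sup>n\<parallel> \<le> C s\<^sup>n\<close> for all \<open>n\<close> at once, and
  repeating this makes the constant tend to \<open>1\<close>.
\<close>

lemma symmetric_growth_bound:
  assumes P: "bounded_mat R P" and sym: "\<And>i j. i \<in> R \<Longrightarrow> j \<in> R \<Longrightarrow> P i j = P j i"
    and gr: "growth R P s" and s: "0 < s"
  shows "mat_bound R P s"
proof -
  obtain C0 where C0: "\<forall>n. mat_bound R (mat_pow R P n) (C0 * s ^ n)"
    using gr unfolding growth_def by blast
  define C where "C = max C0 1"
  have C: "C > 0" by (simp add: C_def)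
  have symn: "mat_pow R P n i j = mat_pow R P n j i" if "i \<in> R" "j \<in> R" for n i j
  proof -
    have "mat_pow R P n j i = mat_pow R (mat_adj P) n i j"
      using mat_pow_adj[OF P that] by simp
    also have "\<dots> = mat_pow R P n i j"
      unfolding mat_pow_def
      by (rule mat_prod_list_cong) (use sym that in \<open>auto simp: mat_adj_def list_all2_conv_all_nth\<close>)
    finally show ?thesis by simp
  qed
  have "mat_bound R (mat_pow R P n) (C powr ((1/2) ^ k) * s ^ n)" for k n
  proof (induction k arbitrary: n)
    case 0
    have "C0 * s ^ n \<le> C * s ^ n" using s by (intro mult_right_mono) (auto simp: C_def)
    then show ?case using mat_bound_mono_const[OF C0[rule_format, of n]] C by simp
  next
    case (Suc k)
    let ?Q = "mat_pow R P n"
    have "mat_bound R (mat_times R (mat_adj ?Q) ?Q) (C powr ((1/2) ^ k) * s ^ (n + n))"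
    proof (rule mat_bound_cong[OF Suc[of "n + n"]])
      fix i j assume ij: "i \<in> R" "j \<in> R"
      show "mat_times R (mat_adj ?Q) ?Q i j = mat_pow R P (n + n) i j"
        unfolding mat_pow_add[OF P ij]
        by (rule mat_times_cong) (use symn ij in \<open>auto simp: mat_adj_def\<close>)
    qed
    from mat_bound_sqrt[OF bounded_mat_pow[OF P] this]
    have "mat_bound R ?Q (sqrt (C powr ((1/2) ^ k)) * s ^ n)"
      using s by (simp add: real_sqrt_mult power_add)
    moreover have "sqrt (C powr ((1/2) ^ k)) = C powr ((1/2) ^ Suc k)"
      by (simp add: powr_half_sqrt[symmetric] powr_powr mult.commute)
    ultimately show ?case by simp
  qed
  from this[of 1] have "mat_bound R (mat_pow R P 1) (C powr ((1/2) ^ k) * s)" for k by simp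
  then have ev: "\<forall>\<^sub>F k in sequentially. mat_bound R (mat_pow R P 1) (C powr ((1/2) ^ k) * s)"
    by simp
  have "(\<lambda>k. C powr ((1/2) ^ k) * s) \<longlonglongrightarrow> C powr 0 * s"
    using C by (intro tendsto_intros LIMSEQ_power_zero) auto
  then have "(\<lambda>k. C powr ((1/2) ^ k) * s) \<longlonglongrightarrow> s" using C by simp
  from mat_bound_tendsto[OF this ev] have "mat_bound R (mat_pow R P 1) s" by simp
  then show ?thesis by (rule mat_bound_cong) (simp add: mat_pow_1 del: mat_pow_Suc)
qed

lemma norm_le_of_growth:
  assumes M: "bounded_mat R M" and gr: "growth R (mat_times R (mat_adj M) M) s" and s: "0 < s"
  shows "mat_norm R M \<le> sqrt s"
proof -
  have "mat_bound R (mat_times R (mat_adj M) M) s"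
  proof (rule symmetric_growth_bound[OF _ _ gr s])
    show "bounded_mat R (mat_times R (mat_adj M) M)"
      by (intro bounded_mat_times bounded_mat_adj M)
    show "mat_times R (mat_adj M) M i j = mat_times R (mat_adj M) M j i" for i j
      by (simp add: mat_times_def mat_adj_def mult.commute)
  qed
  then show ?thesis by (intro mat_bound_norm_le mat_bound_sqrt M)
qed

lemma le_powr_of_right:
  fixes a r t :: real
  assumes "0 < t" "0 \<le> r" "\<And>s. r < s \<Longrightarrow> a \<le> s powr t"
  shows "a \<le> r powr t"
proof (rule tendsto_lowerbound)
  have "eventually (\<lambda>s. r < s) (at_right r)" by (rule eventually_at_right_less)
  then have "eventually (\<lambda>s. 0 \<le> s) (at_right r)" by (rule eventually_mono) (use assms in auto)
  then show "((\<lambda>s. s powr t) \<longlongrightarrow> r powr t) (at_right r)"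
    using assms by (intro tendsto_powr2 tendsto_intros) auto
  show "\<forall>\<^sub>F s in at_right r. a \<le> s powr t"
    using eventually_at_right_less by (rule eventually_mono) (rule assms)
qed simp

section \<open>The chain of inequalities\<close>

lemma growth_cong:
  assumes "bounded_mat R L" "\<And>i j. i \<in> R \<Longrightarrow> j \<in> R \<Longrightarrow> K i j = L i j" "growth R L s"
  shows "growth R K s"
proof (rule growth_mono[OF assms(1) _ assms(3)])
  fix i j assume "i \<in> R" "j \<in> R"
  then show "0 \<le> K i j \<and> K i j \<le> L i j"
    using assms(1,2) by (auto simp: bounded_mat_def mat_bound_nonneg)
qed

text \<open>
  Let \<open>M\<close> be the Hadamard product of the \<open>H\<^sub>l\<^sup>(\<^sup>\<alpha>\<^sup>)\<close>, so that \<open>\<parallel>M\<parallel>\<^sup>2 = r(M\<^sup>* M)\<close>. Its factors may be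
  enumerated by \<open>\<sigma>\<close> in \<open>M\<^sup>*\<close> and independently by \<open>\<rho>\<close> in \<open>M\<close>; whatever factors are paired in this
  way, Hoelder's inequality bounds \<open>M\<^sup>* M\<close> entrywise.
\<close>

lemma norm_hadamard_le_spectral_radius:
  assumes R: "R \<noteq> {}" and m: "m > 0" and \<alpha>: "1 \<le> \<alpha> * real m"
    and H: "\<And>l. l \<in> {1..m} \<Longrightarrow> bounded_mat R (H l)"
    and \<sigma>: "bij_betw \<sigma> {1..m} {1..m}" and \<rho>: "bij_betw \<rho> {1..m} {1..m}"
  defines "A \<equiv> (\<lambda>l. mat_times R (mat_adj (H (\<sigma> l))) (H (\<rho> l)))"
  shows "mat_norm R (hadamard_pow_prod \<alpha> H m)
    \<le> mat_spectral_radius R (hadamard_pow_prod \<alpha> A m) powr (1 / 2)"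
proof -
  let ?M = "hadamard_pow_prod \<alpha> H m" and ?A = "hadamard_pow_prod \<alpha> A m"
  have \<sigma>\<rho>: "\<sigma> l \<in> {1..m}" "\<rho> l \<in> {1..m}" if "l \<in> {1..m}" for l
    using bij_betwE[OF \<sigma>] bij_betwE[OF \<rho>] that by blast+
  have M: "bounded_mat R ?M" by (rule bounded_mat_hadamard[OF m \<alpha> H])
  have A: "bounded_mat R ?A"
    unfolding A_def by (intro bounded_mat_hadamard[OF m \<alpha>] bounded_mat_times bounded_mat_adj H \<sigma>\<rho>)
  have M1: "mat_adj ?M = hadamard_pow_prod \<alpha> (\<lambda>l. mat_adj (H (\<sigma> l))) m"
    using prod.reindex_bij_betw[OF \<sigma>, symmetric]
    by (auto simp: fun_eq_iff mat_adj_def hadamard_pow_prod_apply)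
  have M2: "?M = hadamard_pow_prod \<alpha> (\<lambda>l. H (\<rho> l)) m"
    using prod.reindex_bij_betw[OF \<rho>, symmetric]
    by (auto simp: fun_eq_iff hadamard_pow_prod_apply)
  have le: "mat_times R (mat_adj ?M) ?M i j \<le> ?A i j" if "i \<in> R" "j \<in> R" for i j
  proof -
    have "mat_times R (mat_adj ?M) ?M i j = mat_times R
        (hadamard_pow_prod \<alpha> (\<lambda>l. mat_adj (H (\<sigma> l))) m) (hadamard_pow_prod \<alpha> (\<lambda>l. H (\<rho> l)) m) i j"
      by (simp only: M1 flip: M2)
    also have "\<dots> \<le> ?A i j"
      unfolding A_def by (intro mat_times_hadamard_le[OF m \<alpha> _ _ that] bounded_mat_adj H \<sigma>\<rho>)
    finally show ?thesis .
  qed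
  have nn: "0 \<le> mat_times R (mat_adj ?M) ?M i j" for i j
    by (auto simp: mat_times_def mat_adj_def hadamard_pow_prod_nonneg intro!: infsum_nonneg)
  show ?thesis
  proof (rule le_powr_of_right)
    show r0: "0 \<le> mat_spectral_radius R ?A" by (rule spectral_radius_nonneg[OF A R])
    fix s assume s: "mat_spectral_radius R ?A < s"
    then have s0: "0 < s" using r0 by simp
    have "growth R (mat_times R (mat_adj ?M) ?M) s"
      by (rule growth_mono[OF A _ growth_above_spectral_radius[OF A R s]]) (use nn le in blast)
    from norm_le_of_growth[OF M this s0]
    show "mat_norm R ?M \<le> s powr (1 / 2)" using s0 by (simp add: powr_half_sqrt)
  qed simp
qed

text \<open>
  This is \<open>r(B \<circ> B\<^sup>*) \<le> r(B) r(B\<^sup>*) = r(B)\<^sup>2\<close>.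
\<close>

lemma spectral_radius_schur_adj_le:
  assumes R: "R \<noteq> {}" and B: "bounded_mat R B"
  shows "mat_spectral_radius R (\<lambda>i j. B i j * mat_adj B i j) powr (1 / 2) \<le> mat_spectral_radius R B"
proof (rule dense_ge)
  fix s assume s: "mat_spectral_radius R B < s"
  have s0: "0 < s" using spectral_radius_nonneg[OF B R] s by simp
  note gr = growth_above_spectral_radius[OF B R s]
  obtain C where C: "mat_bound R B C" using B by (auto simp: bounded_mat_def)
  have bd: "bounded_mat R (\<lambda>i j. B i j * mat_adj B i j)"
    unfolding bounded_mat_def
  proof (intro exI, rule mat_bound_mono)
    show "mat_bound R (\<lambda>i j. C * B i j) (C * C)"
      by (rule mat_bound_scale[OF C mat_bound_const_nonneg[OF C]])
    fix i j assume ij: "i \<in> R" "j \<in> R"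
    then show "0 \<le> B i j * mat_adj B i j \<and> B i j * mat_adj B i j \<le> C * B i j"
      using mat_bound_nonneg[OF C] mat_bound_entry[OF C ij(2,1)]
      by (auto simp: mat_adj_def mult.commute[of C] intro!: mult_left_mono)
  qed
  have "growth R (\<lambda>i j. B i j * mat_adj B i j) (s * s)"
    by (intro growth_schur growth_adj bounded_mat_adj B gr s0)
  then have "mat_spectral_radius R (\<lambda>i j. B i j * mat_adj B i j) \<le> s * s"
    using s0 by (intro spectral_radius_le[OF bd R]) auto
  then have "mat_spectral_radius R (\<lambda>i j. B i j * mat_adj B i j) powr (1 / 2) \<le> (s * s) powr (1 / 2)"
    by (intro powr_mono2 spectral_radius_nonneg[OF bd R]) auto
  then show "mat_spectral_radius R (\<lambda>i j. B i j * mat_adj B i j) powr (1 / 2) \<le> s"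
    using s0 by (simp add: powr_half_sqrt)
qed

lemma map_cyclic_shift:
  fixes p :: nat
  assumes "l \<in> {1..p}"
  shows "map (\<lambda>k. if l + k \<le> p then l + k else l + k - p) [0..<p] = [l..<p + 1] @ [1..<l]"
  by (rule nth_equalityI) (use assms in \<open>auto simp: nth_append simp del: upt_Suc\<close>)

lemma bij_cyclic_shift:
  fixes k p :: nat
  assumes "k < p"
  shows "bij_betw (\<lambda>l. if l + k \<le> p then l + k else l + k - p) {1..p} {1..p}"
  unfolding bij_betw_def
proof
  show inj: "inj_on (\<lambda>l. if l + k \<le> p then l + k else l + k - p) {1..p}"
    using assms by (auto simp: inj_on_def split: if_splits)
  show "(\<lambda>l. if l + k \<le> p then l + k else l + k - p) ` {1..p} = {1..p}"
    by (rule endo_inj_surj[OF _ _ inj]) (use assms in auto)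
qed

text \<open>
  In \<open>B\<^sup>p\<close>, the \<open>k\<close>-th factor \<open>B = A\<^sub>1\<^sup>(\<^sup>\<alpha>\<^sup>) \<circ> \<dots> \<circ> A\<^sub>p\<^sup>(\<^sup>\<alpha>\<^sup>)\<close> is written with its Hadamard factors shifted
  cyclically by \<open>k\<close>. Multiplying the \<open>l\<close>-th Hadamard factors together then gives
  \<open>A\<^sub>l \<dots> A\<^sub>p A\<^sub>1 \<dots> A\<^sub>l\<^sub>-\<^sub>1\<close>.
\<close>

lemma mat_pow_hadamard_le_cyclic:
  assumes p: "p > 0" and \<alpha>: "1 \<le> \<alpha> * real p" and A: "\<And>l. l \<in> {1..p} \<Longrightarrow> bounded_mat R (A l)"
    and S: "\<And>l. l \<in> {1..p} \<Longrightarrow> S l = mat_prod_list R (map A ([l..<p + 1] @ [1..<l]))"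
    and ij: "i \<in> R" "j \<in> R"
  shows "0 \<le> mat_pow R (hadamard_pow_prod \<alpha> A p) p i j \<and>
    mat_pow R (hadamard_pow_prod \<alpha> A p) p i j \<le> hadamard_pow_prod \<alpha> S p i j"
proof -
  define \<rho> where "\<rho> l k = (if l + k \<le> p then l + k else l + k - p)" for l k
  have shift: "hadamard_pow_prod \<alpha> (\<lambda>l. A (\<rho> l k)) p = hadamard_pow_prod \<alpha> A p" if "k < p" for k
    unfolding fun_eq_iff hadamard_pow_prod_apply \<rho>_def
    by (intro allI prod.reindex_bij_betw[OF bij_cyclic_shift[OF that]])
  have "map (\<lambda>k. hadamard_pow_prod \<alpha> (\<lambda>l. A (\<rho> l k)) p) [0..<p] =
      map (\<lambda>k. hadamard_pow_prod \<alpha> A p) [0..<p]"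
    using shift by (intro map_cong) auto
  then have 1: "map (\<lambda>k. hadamard_pow_prod \<alpha> (\<lambda>l. A (\<rho> l k)) p) [0..<p] =
      replicate p (hadamard_pow_prod \<alpha> A p)"
    by (simp add: map_replicate_const)
  have "map (\<lambda>k. A (\<rho> l k)) [0..<p] = map A ([l..<p + 1] @ [1..<l])" if "l \<in> {1..p}" for l
    unfolding map_cyclic_shift[OF that, symmetric] \<rho>_def by simp
  then have 2: "hadamard_pow_prod \<alpha> (\<lambda>l. mat_prod_list R (map (\<lambda>k. A (\<rho> l k)) [0..<p])) p i j =
      hadamard_pow_prod \<alpha> S p i j"
    using S by (simp add: hadamard_pow_prod_apply)
  have "bounded_mat R (A (\<rho> l k))" if "l \<in> {1..p}" "k \<in> set [0..<p]" for l k
    using that by (intro A) (auto simp: \<rho>_def)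
  from mat_prod_list_hadamard_le[where K = "\<lambda>l k. A (\<rho> l k)" and ks = "[0..<p]", OF p \<alpha> this ij]
  show ?thesis unfolding 1 2 mat_pow_def .
qed

text \<open>
  By the previous lemma and monotonicity, \<open>r(B)\<^sup>p = r(B\<^sup>p) \<le> r(S\<^sub>1\<^sup>(\<^sup>\<alpha>\<^sup>) \<circ> \<dots> \<circ> S\<^sub>p\<^sup>(\<^sup>\<alpha>\<^sup>))\<close>.
\<close>

lemma spectral_radius_hadamard_le_cyclic:
  assumes R: "R \<noteq> {}" and p: "p > 0" and \<alpha>: "1 \<le> \<alpha> * real p"
    and A: "\<And>l. l \<in> {1..p} \<Longrightarrow> bounded_mat R (A l)"
    and S: "\<And>l. l \<in> {1..p} \<Longrightarrow> S l = mat_prod_list R (map A ([l..<p + 1] @ [1..<l]))"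
    and bS: "bounded_mat R (hadamard_pow_prod \<alpha> S p)"
  shows "mat_spectral_radius R (hadamard_pow_prod \<alpha> A p)
    \<le> mat_spectral_radius R (hadamard_pow_prod \<alpha> S p) powr (1 / real p)"
proof (rule le_powr_of_right)
  let ?B = "hadamard_pow_prod \<alpha> A p" and ?S = "hadamard_pow_prod \<alpha> S p"
  have B: "bounded_mat R ?B" by (rule bounded_mat_hadamard[OF p \<alpha> A])
  show r0: "0 \<le> mat_spectral_radius R ?S" by (rule spectral_radius_nonneg[OF bS R])
  fix s assume s: "mat_spectral_radius R ?S < s"
  have s0: "0 < s" using r0 s by simp
  have "growth R (mat_pow R ?B p) s"
    by (rule growth_mono[OF bS mat_pow_hadamard_le_cyclic[OF p \<alpha> A S]
          growth_above_spectral_radius[OF bS R s]])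
  moreover have "(s powr (1 / real p)) ^ p = s"
    using s0 p by (simp add: powr_realpow[symmetric] powr_powr)
  ultimately have "growth R ?B (s powr (1 / real p))"
    using s0 by (intro growth_root[OF B p]) auto
  then show "mat_spectral_radius R ?B \<le> s powr (1 / real p)"
    by (intro spectral_radius_le[OF B R]) auto
qed (use p in simp)

text \<open>
  With \<open>X = A\<^sub>1 \<dots> A\<^sub>l\<^sub>-\<^sub>1\<close> and \<open>Y = A\<^sub>l \<dots> A\<^sub>p\<close>, the matrices \<open>S\<^sub>l = YX\<close> and \<open>Z = XY\<close> have the same
  spectral radius. Hence \<open>r(S\<^sub>1\<^sup>(\<^sup>\<alpha>\<^sup>) \<circ> \<dots> \<circ> S\<^sub>p\<^sup>(\<^sup>\<alpha>\<^sup>)) \<le> (r(S\<^sub>1) \<dots> r(S\<^sub>p))\<^sup>\<alpha> = r(Z)\<^sup>p\<^sup>\<alpha>\<close>.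
\<close>

lemma spectral_radius_cyclic_le:
  assumes R: "R \<noteq> {}" and p: "p > 0" and \<alpha>: "1 \<le> \<alpha> * real p"
    and A: "\<And>l. l \<in> {1..p} \<Longrightarrow> bounded_mat R (A l)"
    and S: "\<And>l. l \<in> {1..p} \<Longrightarrow> S l = mat_prod_list R (map A ([l..<p + 1] @ [1..<l]))"
    and bS: "bounded_mat R (hadamard_pow_prod \<alpha> S p)"
    and Z: "bounded_mat R Z"
      "\<And>i j. i \<in> R \<Longrightarrow> j \<in> R \<Longrightarrow> Z i j = mat_prod_list R (map A [1..<p + 1]) i j"
  shows "mat_spectral_radius R (hadamard_pow_prod \<alpha> S p) powr (1 / real p)
    \<le> mat_spectral_radius R Z powr \<alpha>"
proof (rule le_powr_of_right)
  let ?S = "hadamard_pow_prod \<alpha> S p"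
  have "0 < 1 / real p" using p by simp
  also have "1 / real p \<le> \<alpha>" using p \<alpha> by (simp add: field_simps)
  finally show "0 < \<alpha>" .
  show r0: "0 \<le> mat_spectral_radius R Z" by (rule spectral_radius_nonneg[OF Z(1) R])
  fix s assume s: "mat_spectral_radius R Z < s"
  have s0: "0 < s" using r0 s by simp
  have prod_bd: "bounded_mat R (mat_prod_list R (map A ls))" if "set ls \<subseteq> {1..p}" for ls
    by (rule bounded_mat_prod_list) (use A that in auto)
  have append: "mat_prod_list R (map A (ks @ ls)) i j =
      mat_times R (mat_prod_list R (map A ks)) (mat_prod_list R (map A ls)) i j"
    if "set ks \<subseteq> {1..p}" "set ls \<subseteq> {1..p}" "i \<in> R" "j \<in> R" for ks ls i j
    unfolding map_append by (rule mat_prod_list_append) (use A that in auto)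
  have S_growth: "bounded_mat R (S l)" "growth R (S l) s" if l: "l \<in> {1..p}" for l
  proof -
    let ?X = "mat_prod_list R (map A [1..<l])" and ?Y = "mat_prod_list R (map A [l..<p + 1])"
    have sub: "set [1..<l] \<subseteq> {1..p}" "set [l..<p + 1] \<subseteq> {1..p}" using l by auto
    have split: "[1..<p + 1] = [1..<l] @ [l..<p + 1]"
      using l upt_add_eq_append[of 1 l "p + 1 - l"] by simp
    have XY: "bounded_mat R ?X" "bounded_mat R ?Y" by (intro prod_bd sub)+
    show "bounded_mat R (S l)"
      unfolding S[OF l] by (rule prod_bd) (use sub in auto)
    have "growth R (mat_times R ?X ?Y) s"
      by (rule growth_cong[OF Z(1) _ growth_above_spectral_radius[OF Z(1) R s]])
        (simp only: Z(2) split append[OF sub])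
    from growth_times_commute[OF XY s0 this]
    show "growth R (S l) s"
      unfolding S[OF l]
      by (rule growth_cong[OF bounded_mat_times[OF XY(2,1)], rotated]) (rule append[OF sub(2,1)])
  qed
  have "growth R ?S (\<Prod>l=1..p. s powr \<alpha>)"
    by (rule growth_hadamard[OF p \<alpha>]) (use S_growth s0 in auto)
  then have "mat_spectral_radius R ?S \<le> (s powr \<alpha>) ^ p"
    by (intro spectral_radius_le[OF bS R]) auto
  then have "mat_spectral_radius R ?S powr (1 / real p) \<le> ((s powr \<alpha>) ^ p) powr (1 / real p)"
    by (intro powr_mono2 spectral_radius_nonneg[OF bS R]) auto
  also have "\<dots> = s powr \<alpha>"
    using s0 p by (simp add: powr_realpow[symmetric] powr_powr)
  finally show "mat_spectral_radius R ?S powr (1 / real p) \<le> s powr \<alpha>" .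
qed

text \<open>
  The two index maps below list the factors of \<open>A\<^sub>1, \<dots>, A\<^sub>2\<^sub>p\<close>: with \<open>\<tau>\<close> applied, the first gives
  the index of the adjoint factor of \<open>A\<^sub>l\<close>, and the second the index of the other one.
\<close>

lemma bij_pair_index:
  fixes p :: nat
  shows "bij_betw (\<lambda>l. if l \<le> p then 2 * l - 1 else 2 * (l - p)) {1..2 * p} {1..2 * p}" (is ?first)
    and "bij_betw (\<lambda>l. if l \<le> p then 2 * l else 2 * (l - p) - 1) {1..2 * p} {1..2 * p}" (is ?second)
proof -
  have inj: "inj_on (\<lambda>l. if l \<le> p then 2 * l - 1 else 2 * (l - p)) {1..2 * p}"
    unfolding inj_on_def by (auto split: if_splits) presburger+
  have "(\<lambda>l. if l \<le> p then 2 * l - 1 else 2 * (l - p)) ` {1..2 * p} = {1..2 * p}"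
    by (rule endo_inj_surj[OF _ _ inj]) auto
  with inj show ?first by (simp add: bij_betw_def)
  have inj: "inj_on (\<lambda>l. if l \<le> p then 2 * l else 2 * (l - p) - 1) {1..2 * p}"
    unfolding inj_on_def by (auto split: if_splits) presburger+
  have "(\<lambda>l. if l \<le> p then 2 * l else 2 * (l - p) - 1) ` {1..2 * p} = {1..2 * p}"
    by (rule endo_inj_surj[OF _ _ inj]) auto
  with inj show ?second by (simp add: bij_betw_def)
qed

theorem theorem3p8:
  fixes R :: "nat set" and m :: nat and \<alpha> :: real and \<tau> :: "nat \<Rightarrow> nat"
    and H A S :: "nat \<Rightarrow> rmat"
  assumes "index_set R"
    and "even m" and "m > 0"
    and "\<alpha> \<ge> 2 / real m"
    and "\<tau> permutes {1..m}"
    and "\<And>j. j \<in> {1..m} \<Longrightarrow> nonneg_mat R (H j)"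
    and "\<And>j. j \<in> {1..m} \<Longrightarrow> defines_operator R (H j)"
    and "\<And>j. j \<in> {1..m div 2} \<Longrightarrow>
           A j = mat_times R (mat_adj (H (\<tau> (2 * j - 1)))) (H (\<tau> (2 * j)))"
    and "\<And>j. j \<in> {1..m div 2} \<Longrightarrow> A (m div 2 + j) = mat_adj (A j)"
    and "\<And>i. i \<in> {1..m div 2} \<Longrightarrow>
           S i = mat_prod_list R (map A ([i..<m div 2 + 1] @ [1..<i]))"
  shows
    "defines_operator R (hadamard_pow_prod \<alpha> H m) \<and>
     defines_operator R (hadamard_pow_prod \<alpha> A m) \<and>
     defines_operator R (hadamard_pow_prod \<alpha> A (m div 2)) \<and>
     defines_operator R (hadamard_pow_prod \<alpha> S (m div 2)) \<and>
     defines_operator R (mat_prod_list R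
       (concat (map (\<lambda>j. [mat_adj (H (\<tau> (2 * j - 1))), H (\<tau> (2 * j))]) [1..<m div 2 + 1]))) \<and>
     (\<forall>j\<in>{1..m div 2}.
       mat_adj (A j) = mat_times R (mat_adj (H (\<tau> (2 * j)))) (H (\<tau> (2 * j - 1)))) \<and>
     mat_norm R (hadamard_pow_prod \<alpha> H m)
       \<le> mat_spectral_radius R (hadamard_pow_prod \<alpha> A m) powr (1 / 2) \<and>
     mat_spectral_radius R (hadamard_pow_prod \<alpha> A m) powr (1 / 2)
       \<le> mat_spectral_radius R (hadamard_pow_prod \<alpha> A (m div 2)) \<and>
     mat_spectral_radius R (hadamard_pow_prod \<alpha> A (m div 2))
       = mat_spectral_radius R (hadamard_pow_prod \<alpha>
           (\<lambda>j. mat_times R (mat_adj (H (\<tau> (2 * j - 1)))) (H (\<tau> (2 * j)))) (m div 2)) \<and>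
     mat_spectral_radius R (hadamard_pow_prod \<alpha>
         (\<lambda>j. mat_times R (mat_adj (H (\<tau> (2 * j - 1)))) (H (\<tau> (2 * j)))) (m div 2))
       \<le> mat_spectral_radius R (hadamard_pow_prod \<alpha> S (m div 2)) powr (2 / real m) \<and>
     mat_spectral_radius R (hadamard_pow_prod \<alpha> S (m div 2)) powr (2 / real m)
       \<le> mat_spectral_radius R (mat_prod_list R
           (concat (map (\<lambda>j. [mat_adj (H (\<tau> (2 * j - 1))), H (\<tau> (2 * j))]) [1..<m div 2 + 1])))
         powr \<alpha>"
proof -
  define p where "p = m div 2"
  have m2: "m = 2 * p" using assms(2) by (simp add: p_def)
  have p: "p > 0" using assms(3) m2 by simp
  have \<alpha>p: "1 \<le> \<alpha> * real p"
    using assms(4) p by (simp add: m2 field_simps)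
  then have \<alpha>m: "1 \<le> \<alpha> * real m" by (simp add: m2)
  have R: "R \<noteq> {}" using assms(1) by (auto simp: index_set_def)
  have \<tau>: "\<tau> l \<in> {1..m}" if "l \<in> {1..m}" for l
    using permutes_in_image[OF assms(5)] that by blast
  have H: "bounded_mat R (H l)" if "l \<in> {1..m}" for l
    using assms(6,7)[OF that] by (simp add: bounded_mat_iff)
  have H\<tau>: "bounded_mat R (H (\<tau> (2 * j - 1)))" "bounded_mat R (H (\<tau> (2 * j)))" if "j \<in> {1..p}" for j
    using that by (intro H \<tau>; simp add: m2; linarith)+
  note A_eq = assms(8)[folded p_def] and A_adj = assms(9)[folded p_def] and S_eq = assms(10)[folded p_def]
  have A: "bounded_mat R (A l)" if "l \<in> {1..p}" for l
    unfolding A_eq[OF that] by (intro bounded_mat_times bounded_mat_adj H\<tau> that)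
  have S: "bounded_mat R (S l)" if "l \<in> {1..p}" for l
    unfolding S_eq[OF that] by (rule bounded_mat_prod_list) (use A that in auto)
  have adj_eq: "mat_adj (A j) = mat_times R (mat_adj (H (\<tau> (2 * j)))) (H (\<tau> (2 * j - 1)))"
    if "j \<in> {1..p}" for j
    unfolding A_eq[OF that] by (simp add: fun_eq_iff mat_adj_def mat_times_def mult.commute)
  let ?HM = "hadamard_pow_prod \<alpha> H m" and ?AM = "hadamard_pow_prod \<alpha> A m"
    and ?B = "hadamard_pow_prod \<alpha> A p" and ?S = "hadamard_pow_prod \<alpha> S p"
  let ?pair = "\<lambda>j. [mat_adj (H (\<tau> (2 * j - 1))), H (\<tau> (2 * j))]"
  let ?Z = "mat_prod_list R (concat (map ?pair [1..<p + 1]))"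
  have bHM: "bounded_mat R ?HM" by (rule bounded_mat_hadamard[OF assms(3) \<alpha>m H])
  have bB: "bounded_mat R ?B" by (rule bounded_mat_hadamard[OF p \<alpha>p A])
  have bS: "bounded_mat R ?S" by (rule bounded_mat_hadamard[OF p \<alpha>p S])
  have pair_bd: "bounded_mat R K" if "j \<in> {1..p}" "K \<in> set (?pair j)" for j K
    using that H\<tau>[OF that(1)] by (auto intro: bounded_mat_adj)
  have bZ: "bounded_mat R ?Z"
    by (rule bounded_mat_prod_list) (use pair_bd in fastforce)
  define \<sigma> where "\<sigma> l = \<tau> (if l \<le> p then 2 * l - 1 else 2 * (l - p))" for l
  define \<rho> where "\<rho> l = \<tau> (if l \<le> p then 2 * l else 2 * (l - p) - 1)" for l
  have \<sigma>: "bij_betw \<sigma> {1..m} {1..m}"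
    using bij_betw_trans[OF bij_pair_index(1)[of p, folded m2] permutes_imp_bij[OF assms(5)]]
    by (simp add: \<sigma>_def comp_def cong: bij_betw_cong)
  have \<rho>: "bij_betw \<rho> {1..m} {1..m}"
    using bij_betw_trans[OF bij_pair_index(2)[of p, folded m2] permutes_imp_bij[OF assms(5)]]
    by (simp add: \<rho>_def comp_def cong: bij_betw_cong)
  have A_factors: "A l = mat_times R (mat_adj (H (\<sigma> l))) (H (\<rho> l))" if l: "l \<in> {1..m}" for l
  proof (cases "l \<le> p")
    case True
    then show ?thesis using A_eq[of l] l by (simp add: \<sigma>_def \<rho>_def)
  next
    case False
    then have "l - p \<in> {1..p}" "l = p + (l - p)" using l m2 by auto
    then have "A l = mat_adj (A (l - p))" using A_adj[of "l - p"] by simp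
    then show ?thesis using adj_eq[OF \<open>l - p \<in> {1..p}\<close>] False by (simp add: \<sigma>_def \<rho>_def)
  qed
  have AM_factors: "?AM = hadamard_pow_prod \<alpha> (\<lambda>l. mat_times R (mat_adj (H (\<sigma> l))) (H (\<rho> l))) m"
    using A_factors by (auto simp: fun_eq_iff hadamard_pow_prod_apply)
  have bAM: "bounded_mat R ?AM"
    unfolding AM_factors
    by (intro bounded_mat_hadamard[OF assms(3) \<alpha>m] bounded_mat_times bounded_mat_adj H)
      (use bij_betwE[OF \<sigma>] bij_betwE[OF \<rho>] in auto)
  have norm: "mat_norm R ?HM \<le> mat_spectral_radius R ?AM powr (1 / 2)"
    unfolding AM_factors
    by (rule norm_hadamard_le_spectral_radius[OF R assms(3) \<alpha>m H \<sigma> \<rho>])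
  have AM_schur: "?AM = (\<lambda>i j. ?B i j * mat_adj ?B i j)"
  proof (intro ext)
    fix i j
    have "(\<Prod>l=1..2 * p. A l i j powr \<alpha>) = (\<Prod>l=1..p. A l i j powr \<alpha>) * (\<Prod>l=p + 1..p + p. A l i j powr \<alpha>)"
      using prod.ub_add_nat[of 1 p "\<lambda>l. A l i j powr \<alpha>" p] by (simp add: mult_2)
    also have "(\<Prod>l=p + 1..p + p. A l i j powr \<alpha>) = (\<Prod>l=1..p. A (p + l) i j powr \<alpha>)"
      using prod.shift_bounds_cl_nat_ivl[of "\<lambda>l. A l i j powr \<alpha>" 1 p p] by (simp add: add.commute)
    also have "\<dots> = (\<Prod>l=1..p. A l j i powr \<alpha>)"
      by (intro prod.cong refl) (simp add: A_adj mat_adj_def)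
    finally show "?AM i j = ?B i j * mat_adj ?B i j"
      by (simp add: hadamard_pow_prod_apply mat_adj_def m2)
  qed
  have AM: "mat_spectral_radius R ?AM powr (1 / 2) \<le> mat_spectral_radius R ?B"
    unfolding AM_schur by (rule spectral_radius_schur_adj_le[OF R bB])
  have B_eq: "?B = hadamard_pow_prod \<alpha>
      (\<lambda>j. mat_times R (mat_adj (H (\<tau> (2 * j - 1)))) (H (\<tau> (2 * j)))) p"
    using A_eq by (auto simp: fun_eq_iff hadamard_pow_prod_apply intro!: prod.cong)
  have exponent: "2 / real m = 1 / real p" by (simp add: m2)
  have B: "mat_spectral_radius R ?B \<le> mat_spectral_radius R ?S powr (2 / real m)"
    unfolding exponent by (rule spectral_radius_hadamard_le_cyclic[OF R p \<alpha>p A S_eq bS])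
  have Z_eq: "?Z i j = mat_prod_list R (map A [1..<p + 1]) i j" if ij: "i \<in> R" "j \<in> R" for i j
  proof -
    have "?Z i j = mat_prod_list R (map (mat_prod_list R) (map ?pair [1..<p + 1])) i j"
      by (rule mat_prod_list_concat[OF _ ij]) (use pair_bd in fastforce)
    also have "\<dots> = mat_prod_list R (map A [1..<p + 1]) i j"
    proof (rule mat_prod_list_cong[OF _ ij])
      have pair_eq: "mat_prod_list R (?pair l) i j = A l i j" if l: "l \<in> {1..p}" and ij: "i \<in> R" "j \<in> R" for l i j
      proof -
        have "mat_prod_list R (?pair l) i j =
            mat_times R (mat_adj (H (\<tau> (2 * l - 1)))) (mat_prod_list R [H (\<tau> (2 * l))]) i j" by simp
        also have "\<dots> = A l i j"
          unfolding A_eq[OF l]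
          by (rule mat_times_cong) (rule refl mat_prod_list_singleton[OF ij(2)])+
        finally show ?thesis .
      qed
      show "list_all2 (\<lambda>K L. \<forall>i\<in>R. \<forall>j\<in>R. K i j = L i j)
          (map (mat_prod_list R) (map ?pair [1..<p + 1])) (map A [1..<p + 1])"
        unfolding list.rel_map list_all2_same by (intro ballI pair_eq) auto
    qed
    finally show ?thesis .
  qed
  have Z: "mat_spectral_radius R ?S powr (2 / real m) \<le> mat_spectral_radius R ?Z powr \<alpha>"
    unfolding exponent by (rule spectral_radius_cyclic_le[OF R p \<alpha>p A S_eq bS bZ Z_eq])
  show ?thesis
    unfolding p_def[symmetric]
    using bHM bAM bB bS bZ adj_eq norm AM B Z unfolding B_eq[symmetric] bounded_mat_iff by blast
qed

end
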